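(* Let $\mathcal{X}$ and $\mathcal{Y}$ be metric spaces, $\mathcal{F}=\mathcal{B}(\mathcal{X})$ and $\mathcal{G}=\mathcal{B}(\mathcal{Y})$ their Borel $\sigma$-fields, $\mu$ a probability measure on $\mathcal{F}$ and $\nu$ a probability measure on $\mathcal{G}$. Let $c:\mathcal{X}\times\mathcal{Y}\rightarrow\mathbb{R}$ be a function such that $f_1+g_1\le c\le f_2+g_2$ everywhere on $\mathcal{X}\times\mathcal{Y}$ for some $f_1,f_2\in L_1(\mu)$ and $g_1,g_2\in L_1(\nu)$. Suppose at least one of $\mu$ and $\nu$ is separable. Then $\alpha^*(c)=\beta^*(c)$ if $c$ is lower-semicontinuous (with respect to the product topology on $\mathcal{X}\times\mathcal{Y}$), and $\alpha(c)=\beta(c)$ if $c$ is upper-semicontinuous (with respect to the product topology).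
   Context: Let $\mathcal{H}=\mathcal{F}\otimes\mathcal{G}$ be the product $\sigma$-field on $\mathcal{X}\times\mathcal{Y}$ and $\Gamma(\mu,\nu)$ the set of ($\sigma$-additive) probability measures $P$ on $\mathcal{H}$ with marginals $\mu$ and $\nu$, i.e. $P(A\times\mathcal{Y})=\mu(A)$ and $P(\mathcal{X}\times B)=\nu(B)$ for all $A\in\mathcal{F}$, $B\in\mathcal{G}$. $L_1(\mu)$ is the class of $\mathcal{F}$-measurable, $\mu$-integrable functions $\mathcal{X}\to\mathbb{R}$ (real-valued, not identified when a.s. equal); similarly $L_1(\nu)$. Write $\mu(f)=\int f\,d\mu$, and similarly for other measures. For $f:\mathcal{X}\to\mathbb{R}$ and $g:\mathcal{Y}\to\mathbb{R}$, $f+g$ denotes the function $(x,y)\mapsto f(x)+g(y)$ on $\mathcal{X}\times\mathcal{Y}$. Let $L=\{f+g: f\in L_1(\mu),\ g\in L_1(\nu)\}$. A Borel probability measure on a metric space is separable if it gives measure $1$ to some separable Borel set. The function $c$ is not required to be $\mathcal{H}$-measurable. In the cases considered there are $A\in\mathcal{F}$, $B\in\mathcal{G}$ with $\mu(A)=\nu(B)=1$ such that $c\,1_{A\times B}$ is $\mathcal{H}$-measurable, so $c$ is measurable with respect to the completion $\overline{P}$ of each $P\in\Gamma(\mu,\nu)$, and one defines $$\alpha(c)=\inf_{P\in\Gamma(\mu,\nu)}\overline{P}(c),\qquad \alpha^*(c)=\sup_{P\in\Gamma(\mu,\nu)}\overline{P}(c),$$ $$\beta(c)=\sup\{\mu(f)+\nu(g):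 f+g\in L,\ f+g\le c\},\qquad \beta^*(c)=\inf\{\mu(f)+\nu(g): f+g\in L,\ f+g\ge c\},$$ where the inequalities hold everywhere on $\mathcal{X}\times\mathcal{Y}$. *)

theory Defs
  imports "HOL-Probability.Probability"
begin

text \<open>On a product type, \<^term>\<open>open\<close> refers to the product topology.\<close>

definition lower_semicont :: "('a::topological_space \<Rightarrow> real) \<Rightarrow> bool" where
  "lower_semicont f \<longleftrightarrow> (\<forall>t. open {x. f x > t})"

definition upper_semicont :: "('a::topological_space \<Rightarrow> real) \<Rightarrow> bool" where
  "upper_semicont f \<longleftrightarrow> (\<forall>t. open {x. f x < t})"

definition separable_measure :: "'a::metric_space measure \<Rightarrow> bool" where
  "separable_measure M \<longleftrightarrow>
     (\<exists>A\<in>sets M. separable_space (top_of_set A) \<and> measure M A = 1)"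

text \<open>For Borel measures on non-separable spaces, the \<open>\<sigma>\<close>-field of \<^term>\<open>M \<Otimes>\<^sub>M N\<close> can be
  strictly smaller than the Borel \<open>\<sigma>\<close>-field of the product type.\<close>

definition couplings :: "'a measure \<Rightarrow> 'b measure \<Rightarrow> ('a \<times> 'b) measure set" where
  "couplings M N = {P. prob_space P \<and> sets P = sets (M \<Otimes>\<^sub>M N) \<and>
     (\<forall>A\<in>sets M. measure P (A \<times> space N) = measure M A) \<and>
     (\<forall>B\<in>sets N. measure P (space M \<times> B) = measure N B)}"

text \<open>The values are taken in the extended reals, so that suprema and infima of empty or
  unbounded sets follow the usual conventions. The Bochner integrals in the next two definitions
  are \<open>0\<close> if \<^term>\<open>c\<close> is not integrable for the completion; lemma
  \<open>integrable_completion_coupling\<close> below shows that this does not occur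
  for the semicontinuous functions \<^term>\<open>c\<close> considered here.\<close>

definition primal_inf :: "'a measure \<Rightarrow> 'b measure \<Rightarrow> ('a \<times> 'b \<Rightarrow> real) \<Rightarrow> ereal" where
  "primal_inf M N c = (INF P\<in>couplings M N. ereal (integral\<^sup>L (completion P) c))"

definition primal_sup :: "'a measure \<Rightarrow> 'b measure \<Rightarrow> ('a \<times> 'b \<Rightarrow> real) \<Rightarrow> ereal" where
  "primal_sup M N c = (SUP P\<in>couplings M N. ereal (integral\<^sup>L (completion P) c))"

definition dual_sup :: "'a measure \<Rightarrow> 'b measure \<Rightarrow> ('a \<times> 'b \<Rightarrow> real) \<Rightarrow> ereal" where
  "dual_sup M N c = Sup {ereal (integral\<^sup>L M f + integral\<^sup>L N g) | f g.
     integrable M f \<and> integrable N g \<and> (\<forall>x\<in>space M. \<forall>y\<in>space N. f x + g y \<le> c (x, y))}"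

definition dual_inf :: "'a measure \<Rightarrow> 'b measure \<Rightarrow> ('a \<times> 'b \<Rightarrow> real) \<Rightarrow> ereal" where
  "dual_inf M N c = Inf {ereal (integral\<^sup>L M f + integral\<^sup>L N g) | f g.
     integrable M f \<and> integrable N g \<and> (\<forall>x\<in>space M. \<forall>y\<in>space N. c (x, y) \<le> f x + g y)}"

lemma open_Int_separable_times_UNIV:
  fixes U :: "('a::metric_space \<times> 'b::metric_space) set"
  assumes U: "open U" and A: "A \<in> sets borel" and sep: "separable_space (top_of_set A)"
  shows "U \<inter> (A \<times> UNIV) \<in> sets (borel \<Otimes>\<^sub>M borel)"
proof -
  obtain D where D: "countable D" "D \<subseteq> A" "(top_of_set A) closure_of D = A"
    using sep unfolding separable_space_def by auto
  have dense: "A \<subseteq> closure D"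
    using D by (simp add: closure_of_subtopology inf.absorb2) blast
  define V where "V d n = \<Union>{W. open W \<and> ball d (1 / real (Suc n)) \<times> W \<subseteq> U}" for d n
  have "U \<inter> (A \<times> UNIV) = (\<Union>d\<in>D. \<Union>n. (ball d (1 / real (Suc n)) \<inter> A) \<times> V d n)"
  proof (intro subset_antisym subsetI)
    fix z assume z: "z \<in> U \<inter> (A \<times> UNIV)"
    obtain x y where xy: "z = (x, y)" by (cases z)
    obtain S W where SW: "open S" "open W" "(x, y) \<in> S \<times> W" "S \<times> W \<subseteq> U"
      using open_prod_elim[OF U, of z] z xy by auto
    then obtain e where e: "e > 0" "ball x e \<subseteq> S"
      by (meson SigmaD1 openE)
    obtain n where n: "1 / real (Suc n) < e / 2"
      using e by (metis half_gt_zero nat_approx_posE)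
    have "x \<in> closure D" using z xy dense by auto
    then obtain d where d: "d \<in> D" "dist d x < 1 / real (Suc n)"
      unfolding closure_approachable by (metis of_nat_0_less_iff zero_less_Suc zero_less_divide_1_iff)
    have "ball d (1 / real (Suc n)) \<subseteq> ball x e"
    proof
      fix w assume "w \<in> ball d (1 / real (Suc n))"
      then have "dist d w < e / 2" "dist d x < e / 2" using d n by auto
      then show "w \<in> ball x e"
        using dist_triangle2[of x w d] by (simp add: dist_commute)
    qed
    then have "ball d (1 / real (Suc n)) \<times> W \<subseteq> U" using e SW by blast
    then have "y \<in> V d n" unfolding V_def using SW by auto
    then show "z \<in> (\<Union>d\<in>D. \<Union>n. (ball d (1 / real (Suc n)) \<inter> A) \<times> V d n)"
      using d z xy by auto
  qed (auto simp: V_def)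
  moreover have "open (V d n)" for d n
    unfolding V_def by auto
  then have "(ball d (1 / real (Suc n)) \<inter> A) \<times> V d n \<in> sets (borel \<Otimes>\<^sub>M borel)" for d n
    using A by (intro pair_measureI) auto
  then have "(\<Union>d\<in>D. \<Union>n. (ball d (1 / real (Suc n)) \<inter> A) \<times> V d n)
      \<in> sets (borel \<Otimes>\<^sub>M borel)"
    using D by (intro sets.countable_UN' sets.countable_UN) auto
  ultimately show ?thesis by simp
qed

lemma open_Int_UNIV_times_separable:
  fixes U :: "('a::metric_space \<times> 'b::metric_space) set"
  assumes U: "open U" and B: "B \<in> sets borel" and sep: "separable_space (top_of_set B)"
  shows "U \<inter> (UNIV \<times> B) \<in> sets (borel \<Otimes>\<^sub>M borel)"
proof -
  have sw: "prod.swap \<in> (borel :: 'a measure) \<Otimes>\<^sub>M (borel :: 'b measure) \<rightarrow>\<^sub>M borel \<Otimes>\<^sub>M borel"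
    by (simp add: prod.swap_def[abs_def])
  have "open (prod.swap -` U :: ('b \<times> 'a) set)"
    by (intro open_vimage U continuous_on_swap)
  then have "(prod.swap -` U) \<inter> (B \<times> UNIV) \<in> sets (borel \<Otimes>\<^sub>M borel)"
    using B sep by (rule open_Int_separable_times_UNIV)
  from measurable_sets[OF sw this] show ?thesis
    by (elim back_subst[of "\<lambda>S. S \<in> _"]) (auto simp: space_pair_measure)
qed

lemma coupling_marginals:
  assumes M: "prob_space M" and N: "prob_space N" and P: "P \<in> couplings M N"
  shows "distr P M fst = M" "distr P N snd = N"
proof -
  interpret M: prob_space M by fact
  interpret N: prob_space N by fact
  interpret P: prob_space P using P by (simp add: couplings_def)
  have sP[measurable_cong]: "sets P = sets (M \<Otimes>\<^sub>M N)" using P by (simp add: couplings_def)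
  have spP: "space P = space M \<times> space N"
    using sets_eq_imp_space_eq[OF sP] by (simp add: space_pair_measure)
  show "distr P M fst = M"
  proof (rule measure_eqI)
    fix A assume A: "A \<in> sets (distr P M fst)"
    then have "fst -` A \<inter> space P = A \<times> space N"
      using sets.sets_into_space[of A M] spP by auto
    then show "emeasure (distr P M fst) A = emeasure M A"
      using A P by (simp add: emeasure_distr couplings_def P.emeasure_eq_measure M.emeasure_eq_measure)
  qed simp
  show "distr P N snd = N"
  proof (rule measure_eqI)
    fix A assume A: "A \<in> sets (distr P N snd)"
    then have "snd -` A \<inter> space P = space M \<times> A"
      using sets.sets_into_space[of A N] spP by auto
    then show "emeasure (distr P N snd) A = emeasure N A"
      using A P by (simp add: emeasure_distr couplings_def P.emeasure_eq_measure N.emeasure_eq_measure)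
  qed simp
qed

lemma integrable_completion_coupling:
  fixes c :: "'a::metric_space \<times> 'b::metric_space \<Rightarrow> real"
  assumes M: "prob_space M" and sM: "sets M = sets borel"
    and N: "prob_space N" and sN: "sets N = sets borel"
    and f1: "integrable M f1" and f2: "integrable M f2"
    and g1: "integrable N g1" and g2: "integrable N g2"
    and bounds: "\<And>x y. f1 x + g1 y \<le> c (x, y) \<and> c (x, y) \<le> f2 x + g2 y"
    and sep: "separable_measure M \<or> separable_measure N"
    and c: "lower_semicont c \<or> upper_semicont c"
    and P: "P \<in> couplings M N"
  shows "integrable (completion P) c"
proof -
  interpret M: prob_space M by fact
  interpret N: prob_space N by fact
  interpret P: prob_space P using P by (simp add: couplings_def)
  have sP: "sets P = sets (M \<Otimes>\<^sub>M N)" using P by (simp add: couplings_def)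
  have sP': "sets P = sets (borel \<Otimes>\<^sub>M borel)"
    unfolding sP by (intro sets_pair_measure_cong sM sN)
  have UM: "space M = UNIV" "space N = UNIV"
    using sets_eq_imp_space_eq[OF sM] sets_eq_imp_space_eq[OF sN] by auto
  have spP: "space P = UNIV"
    using sets_eq_imp_space_eq[OF sP'] by (simp add: space_pair_measure)
  obtain R where R: "R \<in> sets P" "measure P R = 1"
    and RU: "\<And>U. open U \<Longrightarrow> U \<inter> R \<in> sets P"
    using sep
  proof
    assume "separable_measure M"
    then obtain A where A: "A \<in> sets M" "separable_space (top_of_set A)" "measure M A = 1"
      unfolding separable_measure_def by blast
    show ?thesis
    proof (rule that[of "A \<times> UNIV"])
      show "A \<times> UNIV \<in> sets P" unfolding sP' using A sM by (intro pair_measureI) auto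
      show "measure P (A \<times> UNIV) = 1" using P A UM by (auto simp: couplings_def)
      show "\<And>U. open U \<Longrightarrow> U \<inter> (A \<times> UNIV) \<in> sets P"
        unfolding sP' using A sM by (auto intro: open_Int_separable_times_UNIV)
    qed
  next
    assume "separable_measure N"
    then obtain B where B: "B \<in> sets N" "separable_space (top_of_set B)" "measure N B = 1"
      unfolding separable_measure_def by blast
    show ?thesis
    proof (rule that[of "UNIV \<times> B"])
      show "UNIV \<times> B \<in> sets P" unfolding sP' using B sN by (intro pair_measureI) auto
      show "measure P (UNIV \<times> B) = 1" using P B UM by (auto simp: couplings_def)
      show "\<And>U. open U \<Longrightarrow> U \<inter> (UNIV \<times> B) \<in> sets P"
        unfolding sP' using B sN by (auto intro: open_Int_UNIV_times_separable)
    qed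
  qed
  have AE_R: "AE z in P. z \<in> R"
    using R P.prob_eq_1[OF R(1)] by simp
  have null: "- R \<in> null_sets P"
  proof -
    have "- R \<in> sets P" using sets.compl_sets[OF R(1)] spP by (simp add: Compl_eq_Diff_UNIV)
    then show ?thesis using AE_R by (simp add: AE_iff_null_sets)
  qed
  have op: "U \<in> sets (completion P)" if "open U" for U
  proof -
    have "U - R \<in> null_sets (completion P)"
      by (rule null_sets_completion_subset[OF _ null_sets_completionI[OF null]]) auto
    then have "(U \<inter> R) \<union> (U - R) \<in> sets (completion P)"
      using RU[OF that] by (intro sets.Un) auto
    then show ?thesis by (simp add: Int_Diff_Un)
  qed
  have meas: "c \<in> borel_measurable (completion P)"
    using c
  proof
    assume "lower_semicont c"
    then show ?thesis unfolding borel_measurable_iff_greater lower_semicont_def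
      using op by (auto simp: spP)
  next
    assume "upper_semicont c"
    then show ?thesis unfolding borel_measurable_iff_less upper_semicont_def
      using op by (auto simp: spP)
  qed
  have m1: "fst \<in> measurable P M" and m2: "snd \<in> measurable P N"
    using measurable_cong_sets[OF sP refl, of M] measurable_cong_sets[OF sP refl, of N] by auto
  have iM: "integrable P (\<lambda>z. h (fst z))" if "integrable M h" for h :: "'a \<Rightarrow> real"
    using that m1 coupling_marginals(1)[OF M N P] by (metis integrable_distr)
  have iN: "integrable P (\<lambda>z. h (snd z))" if "integrable N h" for h :: "'b \<Rightarrow> real"
    using that m2 coupling_marginals(2)[OF M N P] by (metis integrable_distr)
  let ?b = "\<lambda>z. \<bar>f1 (fst z)\<bar> + \<bar>g1 (snd z)\<bar> + (\<bar>f2 (fst z)\<bar> + \<bar>g2 (snd z)\<bar>)"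
  have b: "integrable P ?b"
    by (intro Bochner_Integration.integrable_add integrable_abs iM iN f1 f2 g1 g2)
  have "integrable (completion P) ?b"
    using b by (subst integrable_completion) (auto dest: borel_measurable_integrable)
  then show ?thesis
  proof (rule Bochner_Integration.integrable_bound[OF _ meas])
    have "\<bar>c z\<bar> \<le> ?b z" for z
      using bounds[of "fst z" "snd z"] by (simp add: abs_le_iff) linarith
    then show "AE z in completion P. norm (c z) \<le> norm (?b z)"
      by (intro AE_I2) (simp add: order_trans[OF _ abs_ge_self])
  qed
qed

end

theory Submission
  imports Defs
begin

text \<open>By replacing \<open>c\<close> with \<open>-c\<close> it suffices to treat lower semicontinuous \<open>c\<close>, and by
  truncation bounded ones with values in \<open>[0, C]\<close>. Up to a product null set given by the
  separable marginal, each \<open>{c > q}\<close> is a countable union of measurable rectangles, so \<open>c\<close> is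
  the increasing limit of functions \<open>c\<^sub>n\<close> that are constant on the cells of finite product
  partitions. For \<open>c\<^sub>n\<close> duality is a finite transport problem with potentials in \<open>[0, C]\<close>.
  Potentials of almost minimal \<open>L\<^sup>2\<close> norm have an almost everywhere convergent subsequence.
  Its limit, set to \<open>C\<close> where there is no convergence, dominates \<open>c\<close> everywhere, and its value
  is at most the supremum of the primal values of the \<open>c\<^sub>n\<close>, which is at most that of \<open>c\<close>.\<close>

text \<open>The limit is therefore taken on the dual side only, and the primal side enters just
  through monotonicity: step functions below \<open>c\<close> have primal values below that of
  \<open>c\<close>. This is why the approximation must come from below, which is what lower
  semicontinuity provides. The dual inequality has to hold at every point, whereas limits of
  potentials exist only almost everywhere. Values in \<open>[0, C]\<close> remove this difficulty: a
  potential equal to \<open>C\<close> at a point dominates \<open>c\<close> there, whatever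
  nonnegative value the other one takes. The same device pays for the null cells of a partition and
  for the null set outside the product set on which \<open>c\<close> is well behaved.\<close>

section \<open>Finite transport problems\<close>

text \<open>Weights are total functions that vanish off \<open>I \<times> J\<close>, so the polytope
  is a closed subset of a product of compact sets \<open>{0..1}\<close> and \<open>{0}\<close>.
  Tychonoff's theorem makes it compact in the product topology, and the independent weights
  \<open>p i * q j\<close> show that it is nonempty.\<close>

lemma transport_polytope_maximizer:
  fixes p :: "'i \<Rightarrow> real" and q :: "'j \<Rightarrow> real" and F :: "('i \<times> 'j \<Rightarrow> real) \<Rightarrow> real"
  assumes fin: "finite I" "finite J"
    and pq: "\<And>i. i \<in> I \<Longrightarrow> 0 \<le> p i" "\<And>j. j \<in> J \<Longrightarrow> 0 \<le> q j" "sum p I = 1" "sum q J = 1"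
    and F: "continuous_on UNIV F"
  defines "S \<equiv> {w. (\<forall>z. z \<notin> I \<times> J \<longrightarrow> w z = 0) \<and> (\<forall>z\<in>I \<times> J. 0 \<le> w z) \<and>
      (\<forall>i\<in>I. (\<Sum>j\<in>J. w (i, j)) = p i) \<and> (\<forall>j\<in>J. (\<Sum>i\<in>I. w (i, j)) = q j)}"
  obtains w where "w \<in> S" "\<And>v. v \<in> S \<Longrightarrow> F v \<le> F w"
proof -
  \<comment> \<open>The constraints of \<open>S\<close> other than vanishing off
    \<open>I \<times> J\<close>, with bounded quantifiers spelled out as implications so that the
    closedness rules and \<open>imp\<close> apply.\<close>
  define T where "T = {w. (\<forall>z. z \<in> I \<times> J \<longrightarrow> 0 \<le> w z) \<and>
      (\<forall>i. i \<in> I \<longrightarrow> (\<Sum>j\<in>J. w (i, j)) = p i) \<and> (\<forall>j. j \<in> J \<longrightarrow> (\<Sum>i\<in>I. w (i, j)) = q j)}"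
  define K where "K = (PiE UNIV (\<lambda>z. if z \<in> I \<times> J then {0..1::real} else {0}))"
  have "compactin (product_topology (\<lambda>_. euclidean) UNIV) K"
    unfolding K_def compactin_PiE by auto
  then have K: "compact K" by (simp add: euclidean_product_topology)
  have imp: "closed {w. Q \<longrightarrow> R w}" if "closed {w. R w}" for Q and R :: "('i \<times> 'j \<Rightarrow> real) \<Rightarrow> bool"
    using that by (cases Q) auto
  have "closed T"
    unfolding T_def
    by (intro closed_Collect_conj closed_Collect_all imp closed_Collect_eq closed_Collect_le
        continuous_on_sum continuous_on_const continuous_on_product_coordinates)
  then have KT: "compact (K \<inter> T)" using K by blast
  have "K \<inter> T = S"
  proof
    show "K \<inter> T \<subseteq> S"
    proof
      fix w assume w: "w \<in> K \<inter> T"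
      then have "w z \<in> (if z \<in> I \<times> J then {0..1} else {0})" for z
        by (simp only: K_def PiE_iff Int_iff) blast
      then have "w z = 0" if "z \<notin> I \<times> J" for z
        using that by (metis singletonD)
      then show "w \<in> S" using w by (auto simp: T_def S_def)
    qed
    show "S \<subseteq> K \<inter> T"
    proof
      fix w assume w: "w \<in> S"
      have "w (i, j) \<le> 1" if ij: "i \<in> I" "j \<in> J" for i j
      proof -
        have "w (i, j) \<le> (\<Sum>j\<in>J. w (i, j))"
          using w ij fin by (intro member_le_sum) (auto simp: S_def)
        also have "\<dots> = p i" using w ij by (auto simp: S_def)
        also have "\<dots> \<le> sum p I" using pq ij fin by (intro member_le_sum) auto
        finally show ?thesis using pq by simp
      qed
      then show "w \<in> K \<inter> T" using w unfolding K_def T_def S_def by auto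
    qed
  qed
  moreover have "(\<lambda>z. if z \<in> I \<times> J then p (fst z) * q (snd z) else 0) \<in> S"
    using pq by (auto simp: S_def simp flip: sum_distrib_left sum_distrib_right)
  ultimately show ?thesis
    using continuous_attains_sup[OF KT _ continuous_on_subset[OF F]] that by fastforce
qed

text \<open>The maximizer of \<open>exp (N * \<Sum>k w) * \<Prod>w\<close> over the transport polytope has positive
  entries. Stationarity under perturbations along four-cycles says that \<open>N * k + 1 / w\<close>
  splits as a sum; summing against \<open>w\<close> bounds the duality gap by
  \<open>card (I \<times> J) / N\<close>.\<close>

lemma finite_transport_potentials:
  fixes p :: "'i \<Rightarrow> real" and q :: "'j \<Rightarrow> real" and k :: "'i \<times> 'j \<Rightarrow> real"
  assumes fin: "finite I" "finite J"
    and pq: "\<And>i. i \<in> I \<Longrightarrow> 0 < p i" "\<And>j. j \<in> J \<Longrightarrow> 0 < q j" "sum p I = 1" "sum q J = 1"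
    and N: "N > 0"
  obtains w f g where "\<And>z. z \<in> I \<times> J \<Longrightarrow> 0 < w z"
    "\<And>i. i \<in> I \<Longrightarrow> (\<Sum>j\<in>J. w (i, j)) = p i" "\<And>j. j \<in> J \<Longrightarrow> (\<Sum>i\<in>I. w (i, j)) = q j"
    "\<And>i j. i \<in> I \<Longrightarrow> j \<in> J \<Longrightarrow> f i + g j = k (i, j) + 1 / (N * w (i, j))"
proof -
  \<comment> \<open>The exponential of the logarithmic barrier objective. Unlike the logarithm, it
    is continuous up to the boundary of the polytope, where entries vanish.\<close>
  define F where "F w = exp (N * (\<Sum>z\<in>I \<times> J. k z * w z)) * (\<Prod>z\<in>I \<times> J. w z)" for w
  define S where "S = {w. (\<forall>z. z \<notin> I \<times> J \<longrightarrow> w z = 0) \<and> (\<forall>z\<in>I \<times> J. 0 \<le> w z) \<and>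
      (\<forall>i\<in>I. (\<Sum>j\<in>J. w (i, j)) = p i) \<and> (\<forall>j\<in>J. (\<Sum>i\<in>I. w (i, j)) = q j)}"
  have "continuous_on UNIV F"
    unfolding F_def by (intro continuous_intros continuous_on_product_coordinates)
  then obtain w where w: "w \<in> S" and max: "\<And>v. v \<in> S \<Longrightarrow> F v \<le> F w"
    using transport_polytope_maximizer[OF fin _ _ pq(3,4), of F thesis] pq(1,2)
    unfolding S_def[symmetric] by (simp add: less_imp_le)
  \<comment> \<open>Independent weights are positive on all of \<open>I \<times> J\<close>, so the
    maximum of \<open>F\<close> is positive and no entry of the maximizer on
    \<open>I \<times> J\<close> can be zero.\<close>
  have "(\<lambda>z. if z \<in> I \<times> J then p (fst z) * q (snd z) else 0) \<in> S" (is "?v \<in> S")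
    using pq by (auto simp: S_def less_imp_le simp flip: sum_distrib_left sum_distrib_right)
  moreover have "0 < F ?v"
    unfolding F_def using pq by (intro mult_pos_pos prod_pos) auto
  ultimately have "0 < F w" using max by fastforce
  then have "(\<Prod>z\<in>I \<times> J. w z) \<noteq> 0" unfolding F_def by auto
  then have w0: "0 < w z" if "z \<in> I \<times> J" for z
    using that w fin by (force simp: S_def less_le)
  have rows: "\<And>i. i \<in> I \<Longrightarrow> (\<Sum>j\<in>J. w (i, j)) = p i" "\<And>j. j \<in> J \<Longrightarrow> (\<Sum>i\<in>I. w (i, j)) = q j"
    using w by (auto simp: S_def)
  \<comment> \<open>The gradient of \<open>ln F\<close> at \<open>w\<close>.\<close>
  define a where "a z = N * k z + 1 / w z" for z
  have ne: "I \<noteq> {}" "J \<noteq> {}" using pq by auto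
  have cycle: "a (i, j) + a (i', j') = a (i, j') + a (i', j)"
    if ij: "i \<in> I" "i' \<in> I" "j \<in> J" "j' \<in> J" for i i' j j'
  proof -
    \<comment> \<open>All row and column sums of this four-cycle are zero. Defined by summands, it
      also covers \<open>i = i'\<close> and \<open>j = j'\<close>, where it vanishes
      identically.\<close>
    define D :: "'i \<times> 'j \<Rightarrow> real" where
      "D z = of_bool (z = (i, j)) + of_bool (z = (i', j')) - of_bool (z = (i, j')) - of_bool (z = (i', j))" for z
    define G where "G t = N * (\<Sum>z\<in>I \<times> J. k z * (w z + t * D z)) + (\<Sum>z\<in>I \<times> J. ln (w z + t * D z))" for t
    \<comment> \<open>Entries of \<open>D\<close> are at most 2 in absolute value, so half the least
      weight is a step size that keeps all perturbed weights positive.\<close>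
    define d where "d = Min (w ` (I \<times> J)) / 2"
    have "Min (w ` (I \<times> J)) > 0" using fin ne w0 by (subst Min_gr_iff) auto
    then have d: "d > 0" "\<And>z. z \<in> I \<times> J \<Longrightarrow> 2 * d \<le> w z"
      using fin by (auto simp: d_def)
    have Dle: "\<bar>D z\<bar> \<le> 2" for z unfolding D_def by auto
    have pos: "0 < w z + t * D z" if "z \<in> I \<times> J" "\<bar>t\<bar> < d" for z t
    proof -
      have "\<bar>t * D z\<bar> \<le> \<bar>t\<bar> * 2" unfolding abs_mult using Dle[of z] by (intro mult_left_mono) auto
      then show ?thesis using d(2)[OF that(1)] that(2) by linarith
    qed
    have lnF: "ln (F (\<lambda>z. w z + t * D z)) = G t" and F0: "0 < F (\<lambda>z. w z + t * D z)" if "\<bar>t\<bar> < d" for t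
    proof -
      have p: "0 < (\<Prod>z\<in>I \<times> J. w z + t * D z)" using pos that by (intro prod_pos) auto
      then show "0 < F (\<lambda>z. w z + t * D z)" unfolding F_def by auto
      show "ln (F (\<lambda>z. w z + t * D z)) = G t"
        unfolding F_def G_def using pos[OF _ that]
        by (subst ln_mult_pos[OF exp_gt_zero p]) (subst ln_prod, use fin in \<open>force+\<close>)
    qed
    have inS: "(\<lambda>z. w z + t * D z) \<in> S" if "\<bar>t\<bar> < d" for t
    proof -
      have "(\<Sum>y\<in>J. D (x, y)) = 0" for x
        unfolding D_def using ij fin by (simp add: sum.distrib sum_subtractf of_bool_conj flip: sum_distrib_left)
      moreover have "(\<Sum>x\<in>I. D (x, y)) = 0" for y
        unfolding D_def using ij fin by (simp add: sum.distrib sum_subtractf of_bool_conj flip: sum_distrib_right)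
      moreover have "D z = 0" if "z \<notin> I \<times> J" for z
        using that ij unfolding D_def by (cases z) auto
      ultimately show ?thesis
        using w pos[OF _ that] unfolding S_def
        by (auto simp: sum.distrib less_imp_le simp flip: sum_distrib_left)
    qed
    have "(G has_real_derivative (N * (\<Sum>z\<in>I \<times> J. k z * D z) + (\<Sum>z\<in>I \<times> J. D z / w z))) (at 0)"
      unfolding G_def using w0 by (auto intro!: derivative_eq_intros simp: field_simps)
    then have "N * (\<Sum>z\<in>I \<times> J. k z * D z) + (\<Sum>z\<in>I \<times> J. D z / w z) = 0"
    proof (rule DERIV_local_max[OF _ d(1)], intro allI impI)
      fix t assume t: "\<bar>0 - t\<bar> < d"
      then have "F (\<lambda>z. w z + t * D z) \<le> F (\<lambda>z. w z + 0 * D z)"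
        using max[OF inS[of t]] by simp
      then have "ln (F (\<lambda>z. w z + t * D z)) \<le> ln (F (\<lambda>z. w z + 0 * D z))"
        using F0[of t] t by simp
      then show "G t \<le> G 0" using lnF[of t] lnF[of 0] t d by simp
    qed
    then have "(\<Sum>z\<in>I \<times> J. a z * D z) = 0"
      by (simp add: a_def sum.distrib sum_distrib_left algebra_simps)
    moreover have "(\<Sum>z\<in>I \<times> J. a z * of_bool (z = y)) = a y" if "y \<in> I \<times> J" for y
      using that fin by (simp add: of_bool_def if_distrib[of "\<lambda>u. a _ * u"] cong: if_cong)
    ultimately show ?thesis
      using ij unfolding D_def by (simp add: algebra_simps sum.distrib sum_subtractf)
  qed
  obtain i0 j0 where ij0: "i0 \<in> I" "j0 \<in> J" using ne by auto
  \<comment> \<open>The cycle identity through the base cell \<open>(i0, j0)\<close> splits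
    \<open>a\<close> into a function of the row and a function of the column; division by
    \<open>N\<close> returns to the scale of \<open>k\<close>.\<close>
  show ?thesis
  proof (rule that[of w "\<lambda>i. a (i, j0) / N" "\<lambda>j. (a (i0, j) - a (i0, j0)) / N"])
    fix i j assume ij: "i \<in> I" "j \<in> J"
    have "a (i, j0) / N + (a (i0, j) - a (i0, j0)) / N = a (i, j) / N"
      using cycle[of i i0 j j0] ij ij0 by (simp flip: add_divide_distrib)
    also have "\<dots> = k (i, j) + 1 / (N * w (i, j))"
      using N by (simp add: a_def add_divide_distrib)
    finally show "a (i, j0) / N + (a (i0, j) - a (i0, j0)) / N = k (i, j) + 1 / (N * w (i, j))" .
  qed (use w0 rows in auto)
qed

text \<open>The barrier potentials already dominate \<open>k\<close> with gap \<open>e\<close>. What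
  remains is to force them into \<open>[0, C]\<close>: a shift by a constant, which cancels between
  the two sums because both total masses are 1, and then a cap at \<open>C\<close>.\<close>

lemma finite_transport_duality:
  fixes p :: "'i \<Rightarrow> real" and q :: "'j \<Rightarrow> real" and k :: "'i \<times> 'j \<Rightarrow> real"
  assumes fin: "finite I" "finite J"
    and pq: "\<And>i. i \<in> I \<Longrightarrow> 0 < p i" "\<And>j. j \<in> J \<Longrightarrow> 0 < q j" "sum p I = 1" "sum q J = 1"
    and k: "\<And>z. z \<in> I \<times> J \<Longrightarrow> 0 \<le> k z \<and> k z \<le> C" and e: "e > 0"
  obtains w f g where "\<And>z. z \<in> I \<times> J \<Longrightarrow> 0 < w z"
    "\<And>i. i \<in> I \<Longrightarrow> (\<Sum>j\<in>J. w (i, j)) = p i" "\<And>j. j \<in> J \<Longrightarrow> (\<Sum>i\<in>I. w (i, j)) = q j"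
    "\<And>i. i \<in> I \<Longrightarrow> 0 \<le> f i \<and> f i \<le> C" "\<And>j. j \<in> J \<Longrightarrow> 0 \<le> g j \<and> g j \<le> C"
    "\<And>i j. i \<in> I \<Longrightarrow> j \<in> J \<Longrightarrow> k (i, j) \<le> f i + g j"
    "(\<Sum>i\<in>I. f i * p i) + (\<Sum>j\<in>J. g j * q j) \<le> (\<Sum>z\<in>I \<times> J. k z * w z) + e"
proof -
  have ne: "I \<noteq> {}" "J \<noteq> {}" using pq by auto
  define n where "n = real (card (I \<times> J))"
  have n: "n > 0" using fin ne by (simp add: n_def card_gt_0_iff)
  \<comment> \<open>With barrier parameter \<open>n / e\<close> each of the \<open>n\<close> cells
    contributes \<open>w z / (n / e * w z) = e / n\<close> to the gap, hence \<open>e\<close> in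
    total.\<close>
  obtain w f g where w: "\<And>z. z \<in> I \<times> J \<Longrightarrow> 0 < w z"
    and rows: "\<And>i. i \<in> I \<Longrightarrow> (\<Sum>j\<in>J. w (i, j)) = p i" "\<And>j. j \<in> J \<Longrightarrow> (\<Sum>i\<in>I. w (i, j)) = q j"
    and fg: "\<And>i j. i \<in> I \<Longrightarrow> j \<in> J \<Longrightarrow> f i + g j = k (i, j) + 1 / (n / e * w (i, j))"
    using finite_transport_potentials[OF fin pq, of "n / e" k] n e by (metis divide_pos_pos)
  have kfg: "k (i, j) \<le> f i + g j" if "i \<in> I" "j \<in> J" for i j
    using fg[OF that] w[of "(i, j)"] that n e by simp
  have "(\<Sum>i\<in>I. f i * p i) = (\<Sum>i\<in>I. \<Sum>j\<in>J. f i * w (i, j))"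
    using rows by (simp flip: sum_distrib_left)
  moreover have "(\<Sum>j\<in>J. g j * q j) = (\<Sum>i\<in>I. \<Sum>j\<in>J. g j * w (i, j))"
    by (subst sum.swap) (use rows in \<open>simp flip: sum_distrib_left\<close>)
  ultimately have "(\<Sum>i\<in>I. f i * p i) + (\<Sum>j\<in>J. g j * q j)
      = (\<Sum>i\<in>I. \<Sum>j\<in>J. (f i + g j) * w (i, j))"
    by (simp add: sum.distrib distrib_right)
  also have "\<dots> = (\<Sum>z\<in>I \<times> J. k z * w z + e / n)"
    unfolding sum.cartesian_product
  proof (intro sum.cong refl)
    fix z assume z: "z \<in> I \<times> J"
    obtain i j where ij: "z = (i, j)" "i \<in> I" "j \<in> J" using z by auto
    show "(case z of (i, j) \<Rightarrow> (f i + g j) * w (i, j)) = k z * w z + e / n"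
      unfolding ij(1) prod.case fg[OF ij(2,3)] using w[OF z] n e ij by (simp add: field_simps)
  qed
  also have "\<dots> = (\<Sum>z\<in>I \<times> J. k z * w z) + e"
    using n by (simp add: sum.distrib n_def)
  finally have val: "(\<Sum>i\<in>I. f i * p i) + (\<Sum>j\<in>J. g j * q j) = (\<Sum>z\<in>I \<times> J. k z * w z) + e" .
  \<comment> \<open>After subtracting its minimum \<open>f\<close> is nonnegative, and
    \<open>g j + m\<close> is nonnegative because it dominates \<open>k\<close> on the row where the
    minimum is attained.\<close>
  define m where "m = Min (f ` I)"
  have m: "m \<le> f i" if "i \<in> I" for i using that fin by (simp add: m_def)
  have "m \<in> f ` I" unfolding m_def using fin ne by (intro Min_in) auto
  then obtain i0 where i0: "i0 \<in> I" "f i0 = m" by auto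
  have gm: "0 \<le> g j + m" if "j \<in> J" for j
    using kfg[OF i0(1) that] k[of "(i0, j)"] i0 that by auto
  have C: "0 \<le> C" using k ne by force
  show ?thesis
  proof (rule that[of w "\<lambda>i. min C (f i - m)" "\<lambda>j. min C (g j + m)"])
    \<comment> \<open>The cap is harmless: if one summand is cut to \<open>C\<close>, it dominates
      \<open>k\<close> alone, as the other is nonnegative.\<close>
    show "k (i, j) \<le> min C (f i - m) + min C (g j + m)" if "i \<in> I" "j \<in> J" for i j
      using kfg[OF that] m[OF that(1)] gm[OF that(2)] k[of "(i, j)"] that by (auto simp: min_def)
    have "(\<Sum>i\<in>I. min C (f i - m) * p i) \<le> (\<Sum>i\<in>I. (f i - m) * p i)"
      using pq by (intro sum_mono mult_right_mono) (auto simp: less_imp_le)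
    also have "\<dots> = (\<Sum>i\<in>I. f i * p i) - m"
      using pq by (simp add: left_diff_distrib sum_subtractf flip: sum_distrib_left)
    finally have 1: "(\<Sum>i\<in>I. min C (f i - m) * p i) \<le> (\<Sum>i\<in>I. f i * p i) - m" .
    have "(\<Sum>j\<in>J. min C (g j + m) * q j) \<le> (\<Sum>j\<in>J. (g j + m) * q j)"
      using pq by (intro sum_mono mult_right_mono) (auto simp: less_imp_le)
    also have "\<dots> = (\<Sum>j\<in>J. g j * q j) + m"
      using pq by (simp add: distrib_right sum.distrib flip: sum_distrib_left)
    finally show "(\<Sum>i\<in>I. min C (f i - m) * p i) + (\<Sum>j\<in>J. min C (g j + m) * q j)
        \<le> (\<Sum>z\<in>I \<times> J. k z * w z) + e"
      using 1 val by linarith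
  qed (use w rows m gm C in auto)
qed

section \<open>Couplings and potentials for step functions\<close>

text \<open>The cells need not cover the space, but total mass 1 makes the remainder null, and so
  invisible to the measure of \<open>A\<close>.\<close>

lemma (in prob_space) sum_prob_Int_partition:
  assumes fin: "finite I" and S: "\<And>i. i \<in> I \<Longrightarrow> S i \<in> events" "disjoint_family_on S I"
    and one: "(\<Sum>i\<in>I. prob (S i)) = 1" and A: "A \<in> events"
  shows "(\<Sum>i\<in>I. prob (A \<inter> S i)) = prob A"
proof -
  have P: "prob (\<Union>i\<in>I. S i) = 1"
    using S(1) by (subst finite_measure_finite_Union[OF fin _ S(2)]) (simp_all add: one image_subset_iff)
  have "prob (\<Union>i\<in>I. S i) = prob (space M)" by (simp only: prob_space P)
  moreover have "(\<Union>i\<in>I. S i) \<in> events" using fin S(1) by (rule sets.finite_UN)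
  ultimately have "prob (A \<inter> (\<Union>i\<in>I. S i)) = prob A"
    by (intro measure_space_inter A)
  moreover have "prob (\<Union>i\<in>I. A \<inter> S i) = (\<Sum>i\<in>I. prob (A \<inter> S i))"
  proof (rule finite_measure_finite_Union[OF fin])
    show "disjoint_family_on (\<lambda>i. A \<inter> S i) I"
      using S(2) unfolding disjoint_family_on_def by blast
  qed (use S(1) A in auto)
  ultimately show ?thesis by (simp only: Int_UN_distrib)
qed

lemma (in prob_space) integral_finite_range:
  fixes u :: "'i \<Rightarrow> real"
  assumes fin: "finite I"
    and \<phi>: "\<phi> \<in> M \<rightarrow>\<^sub>M count_space UNIV"
    and one: "(\<Sum>i\<in>I. prob (\<phi> -` {i} \<inter> space M)) = 1"
  shows "(\<integral>x. u (\<phi> x) \<partial>M) = (\<Sum>i\<in>I. u i * prob (\<phi> -` {i} \<inter> space M))"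
    and "AE x in M. \<phi> x \<in> I"
proof -
  have meas: "\<phi> -` {i} \<inter> space M \<in> events" for i
    using \<phi> by (rule measurable_sets) simp
  have "disjoint_family_on (\<lambda>i. \<phi> -` {i} \<inter> space M) I" by (auto simp: disjoint_family_on_def)
  then have "prob (\<Union>i\<in>I. \<phi> -` {i} \<inter> space M) = 1"
    using finite_measure_finite_Union[OF fin, of "\<lambda>i. \<phi> -` {i} \<inter> space M"] meas one by auto
  then have "AE x in M. x \<in> (\<Union>i\<in>I. \<phi> -` {i} \<inter> space M)"
    using meas fin by (subst (asm) prob_eq_1) (auto simp del: UN_simps intro!: sets.finite_UN)
  then show ae: "AE x in M. \<phi> x \<in> I" by eventually_elim auto
  have "(\<integral>x. u (\<phi> x) \<partial>M) = (\<integral>x. (\<Sum>i\<in>I. u i * indicator (\<phi> -` {i} \<inter> space M) x) \<partial>M)"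
  proof (rule integral_cong_AE)
    have eq: "(\<Sum>i\<in>I. u i * indicator (\<phi> -` {i} \<inter> space M) x) = u (\<phi> x)"
      if "x \<in> space M" "\<phi> x \<in> I" for x
    proof -
      have "(\<Sum>i\<in>I. u i * indicator (\<phi> -` {i} \<inter> space M) x) = (\<Sum>i\<in>I. if \<phi> x = i then u i else 0)"
        using that by (intro sum.cong) (auto simp: indicator_def)
      then show ?thesis using fin that by simp
    qed
    show "AE x in M. u (\<phi> x) = (\<Sum>i\<in>I. u i * indicator (\<phi> -` {i} \<inter> space M) x)"
      using ae AE_space by eventually_elim (simp add: eq)
    show "(\<lambda>x. u (\<phi> x)) \<in> borel_measurable M"
      using \<phi> by (rule measurable_compose) simp
    show "(\<lambda>x. \<Sum>i\<in>I. u i * indicator (\<phi> -` {i} \<inter> space M) x) \<in> borel_measurable M"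
      using meas by (intro borel_measurable_sum borel_measurable_times borel_measurable_indicator) auto
  qed
  also have "\<dots> = (\<Sum>i\<in>I. u i * prob (\<phi> -` {i} \<inter> space M))"
    using meas by (subst Bochner_Integration.integral_sum) (auto simp: emeasure_eq_measure)
  finally show "(\<integral>x. u (\<phi> x) \<partial>M) = (\<Sum>i\<in>I. u i * prob (\<phi> -` {i} \<inter> space M))" .
qed

text \<open>The coupling is the mixture, with weights \<open>w (i, j)\<close>, of the products of
  \<open>M\<close> conditioned on \<open>S i\<close> and \<open>N\<close> conditioned on
  \<open>T j\<close>. Its density with respect to the product measure is the constant
  \<open>v\<close> on each rectangle; the division in \<open>v\<close> is the reason for asking for
  cells of positive measure.\<close>

lemma coupling_of_weights:
  fixes w :: "'i \<times> 'j \<Rightarrow> real"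
  assumes M: "prob_space M" and N: "prob_space N"
    and fin: "finite I" "finite J"
    and S: "\<And>i. i \<in> I \<Longrightarrow> S i \<in> sets M" "disjoint_family_on S I" "\<And>i. i \<in> I \<Longrightarrow> 0 < measure M (S i)"
      "(\<Sum>i\<in>I. measure M (S i)) = 1"
    and T: "\<And>j. j \<in> J \<Longrightarrow> T j \<in> sets N" "disjoint_family_on T J" "\<And>j. j \<in> J \<Longrightarrow> 0 < measure N (T j)"
      "(\<Sum>j\<in>J. measure N (T j)) = 1"
    and w: "\<And>z. z \<in> I \<times> J \<Longrightarrow> 0 \<le> w z"
      "\<And>i. i \<in> I \<Longrightarrow> (\<Sum>j\<in>J. w (i, j)) = measure M (S i)"
      "\<And>j. j \<in> J \<Longrightarrow> (\<Sum>i\<in>I. w (i, j)) = measure N (T j)"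
  obtains P where "P \<in> couplings M N" "\<And>i j. i \<in> I \<Longrightarrow> j \<in> J \<Longrightarrow> measure P (S i \<times> T j) = w (i, j)"
proof -
  interpret M: prob_space M by fact
  interpret N: prob_space N by fact
  define v where "v z = w z / (measure M (S (fst z)) * measure N (T (snd z)))" for z
  have v0: "0 \<le> v z" if "z \<in> I \<times> J" for z using w(1)[OF that] by (simp add: v_def)
  define R where "R z = S (fst z) \<times> T (snd z)" for z
  have R[measurable]: "R z \<in> sets (M \<Otimes>\<^sub>M N)" if "z \<in> I \<times> J" for z
    using that S T by (auto simp: R_def)
  define P where "P = density (M \<Otimes>\<^sub>M N) (\<lambda>x. \<Sum>z\<in>I \<times> J. ennreal (v z) * indicator (R z) x)"
  have em: "emeasure P E = (\<Sum>z\<in>I \<times> J. ennreal (v z) * emeasure (M \<Otimes>\<^sub>M N) (R z \<inter> E))"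
    if E[measurable]: "E \<in> sets (M \<Otimes>\<^sub>M N)" for E
  proof -
    have "emeasure P E = (\<integral>\<^sup>+ x. (\<Sum>z\<in>I \<times> J. ennreal (v z) * indicator (R z) x) * indicator E x \<partial>(M \<Otimes>\<^sub>M N))"
      unfolding P_def by (subst emeasure_density) auto
    also have "\<dots> = (\<integral>\<^sup>+ x. (\<Sum>z\<in>I \<times> J. ennreal (v z) * indicator (R z \<inter> E) x) \<partial>(M \<Otimes>\<^sub>M N))"
      by (simp add: sum_distrib_right indicator_inter_arith mult.assoc)
    also have "\<dots> = (\<Sum>z\<in>I \<times> J. ennreal (v z) * emeasure (M \<Otimes>\<^sub>M N) (R z \<inter> E))"
      by (subst nn_integral_sum) (auto simp: nn_integral_cmult_indicator)
    finally show ?thesis .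
  qed
  have em2: "emeasure P (A \<times> B) = ennreal (\<Sum>z\<in>I \<times> J. v z * measure M (A \<inter> S (fst z)) * measure N (B \<inter> T (snd z)))"
    if AB: "A \<in> sets M" "B \<in> sets N" for A B
  proof -
    have "ennreal (v z) * emeasure (M \<Otimes>\<^sub>M N) (R z \<inter> (A \<times> B)) =
        ennreal (v z * measure M (A \<inter> S (fst z)) * measure N (B \<inter> T (snd z)))" if z: "z \<in> I \<times> J" for z
    proof -
      have "R z \<inter> (A \<times> B) = (A \<inter> S (fst z)) \<times> (B \<inter> T (snd z))" by (auto simp: R_def)
      then have "emeasure (M \<Otimes>\<^sub>M N) (R z \<inter> (A \<times> B)) = emeasure M (A \<inter> S (fst z)) * emeasure N (B \<inter> T (snd z))"
        using z AB S(1) T(1) by (simp only:) (intro N.emeasure_pair_measure_Times sets.Int, auto)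
      then show ?thesis
        using v0[OF z] by (simp add: M.emeasure_eq_measure N.emeasure_eq_measure ennreal_mult' mult.assoc)
    qed
    then have "emeasure P (A \<times> B) =
        (\<Sum>z\<in>I \<times> J. ennreal (v z * measure M (A \<inter> S (fst z)) * measure N (B \<inter> T (snd z))))"
      unfolding em[OF pair_measureI[OF AB]] by (intro sum.cong refl)
    also have "\<dots> = ennreal (\<Sum>z\<in>I \<times> J. v z * measure M (A \<inter> S (fst z)) * measure N (B \<inter> T (snd z)))"
      using v0 by (intro sum_ennreal mult_nonneg_nonneg measure_nonneg)
    finally show ?thesis .
  qed
  have m2: "measure P (A \<times> B) = (\<Sum>z\<in>I \<times> J. v z * measure M (A \<inter> S (fst z)) * measure N (B \<inter> T (snd z)))"
    if AB: "A \<in> sets M" "B \<in> sets N" for A B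
    using em2[OF AB] v0
    by (intro measure_eq_emeasure_eq_ennreal sum_nonneg mult_nonneg_nonneg measure_nonneg)
  have ne: "measure M (S i) \<noteq> 0" "measure N (T j) \<noteq> 0" if "i \<in> I" "j \<in> J" for i j
    using S(3)[OF that(1)] T(3)[OF that(2)] by simp_all
  have mM: "measure P (A \<times> space N) = measure M A" if A: "A \<in> sets M" for A
  proof -
    have "measure P (A \<times> space N) = (\<Sum>z\<in>I \<times> J. v z * measure M (A \<inter> S (fst z)) * measure N (T (snd z)))"
      unfolding m2[OF A sets.top] using T(1) by (intro sum.cong refl) auto
    also have "\<dots> = (\<Sum>i\<in>I. \<Sum>j\<in>J. measure M (A \<inter> S i) / measure M (S i) * w (i, j))"
      unfolding sum.cartesian_product by (intro sum.cong refl) (use ne in \<open>auto simp: v_def\<close>)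
    also have "\<dots> = (\<Sum>i\<in>I. measure M (A \<inter> S i))"
      unfolding sum_distrib_left[symmetric]
      by (intro sum.cong refl) (use S(3) w(2) in \<open>simp add: less_imp_neq[symmetric]\<close>)
    finally show ?thesis using M.sum_prob_Int_partition[OF fin(1) S(1,2,4) A] by simp
  qed
  have mN: "measure P (space M \<times> A) = measure N A" if A: "A \<in> sets N" for A
  proof -
    have "measure P (space M \<times> A) = (\<Sum>z\<in>I \<times> J. v z * measure M (S (fst z)) * measure N (A \<inter> T (snd z)))"
      unfolding m2[OF sets.top A] using S(1) by (intro sum.cong refl) auto
    also have "\<dots> = (\<Sum>i\<in>I. \<Sum>j\<in>J. measure N (A \<inter> T j) / measure N (T j) * w (i, j))"
      unfolding sum.cartesian_product by (intro sum.cong refl) (use ne in \<open>auto simp: v_def\<close>)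
    also have "\<dots> = (\<Sum>j\<in>J. measure N (A \<inter> T j))"
      by (subst sum.swap, unfold sum_distrib_left[symmetric], intro sum.cong refl) (use T(3) w(3) in \<open>simp add: less_imp_neq[symmetric]\<close>)
    finally show ?thesis using N.sum_prob_Int_partition[OF fin(2) T(1,2,4) A] by simp
  qed
  have spP: "space P = space M \<times> space N" by (simp add: P_def space_pair_measure)
  have "emeasure P (space P) = ennreal (measure P (space P))"
    using em2[OF sets.top sets.top] unfolding spP by (intro emeasure_eq_ennreal_measure) simp
  also have "\<dots> = 1"
    using mM[OF sets.top] M.prob_space unfolding spP by simp
  finally have "prob_space P" by (rule prob_spaceI)
  then have "P \<in> couplings M N"
    using mM mN by (auto simp: couplings_def P_def)
  moreover have "measure P (S i \<times> T j) = w (i, j)" if ij: "i \<in> I" "j \<in> J" for i j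
  proof -
    have "measure P (S i \<times> T j) = (\<Sum>z\<in>I \<times> J. if z = (i, j) then w z else 0)"
      unfolding m2[OF S(1)[OF ij(1)] T(1)[OF ij(2)]]
    proof (intro sum.cong refl)
      fix z assume z: "z \<in> I \<times> J"
      have "S i \<inter> S (fst z) = {}" if "fst z \<noteq> i"
        using disjoint_family_onD[OF S(2), of i "fst z"] that z ij by auto
      moreover have "T j \<inter> T (snd z) = {}" if "snd z \<noteq> j"
        using disjoint_family_onD[OF T(2), of j "snd z"] that z ij by auto
      ultimately show "v z * measure M (S i \<inter> S (fst z)) * measure N (T j \<inter> T (snd z)) = (if z = (i, j) then w z else 0)"
        using S(3)[OF ij(1)] T(3)[OF ij(2)] by (cases "fst z = i"; cases "snd z = j") (auto simp: v_def prod_eq_iff)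
    qed
    also have "\<dots> = w (i, j)" using fin ij by simp
    finally show ?thesis .
  qed
  ultimately show ?thesis by (rule that)
qed

text \<open>The finite problem and the coupling built from its weights demand cells of positive
  mass. Dropping the null fibres achieves this and loses no mass.\<close>

lemma (in prob_space) sum_prob_positive_fibres:
  assumes "simple_function M \<phi>"
  defines "I \<equiv> {i\<in>\<phi> ` space M. 0 < prob (\<phi> -` {i} \<inter> space M)}"
  shows "finite I" "(\<Sum>i\<in>I. prob (\<phi> -` {i} \<inter> space M)) = 1"
proof -
  have fin: "finite (\<phi> ` space M)" and meas: "\<phi> -` {i} \<inter> space M \<in> events" for i
    using simple_functionD[OF assms(1)] by auto
  show "finite I" using fin by (simp add: I_def)
  have "(\<Sum>i\<in>I. prob (\<phi> -` {i} \<inter> space M)) = (\<Sum>i\<in>\<phi> ` space M. prob (\<phi> -` {i} \<inter> space M))"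
    using fin by (intro sum.mono_neutral_left) (auto simp: I_def zero_less_measure_iff)
  also have "\<dots> = prob (\<Union>i\<in>\<phi> ` space M. \<phi> -` {i} \<inter> space M)"
    using meas fin by (intro finite_measure_finite_Union[symmetric]) (auto simp: disjoint_family_on_def)
  also have "(\<Union>i\<in>\<phi> ` space M. \<phi> -` {i} \<inter> space M) = space M" by auto
  finally show "(\<Sum>i\<in>I. prob (\<phi> -` {i} \<inter> space M)) = 1" by (simp add: prob_space)
qed

text \<open>The value \<open>k (\<phi> x, \<psi> y)\<close> depends only on the pair of fibres, so
  the finite duality on positive fibres transfers: weights become a coupling and finite potentials
  become simple functions.\<close>

lemma step_duality:
  fixes \<phi> :: "'a \<Rightarrow> 'i" and \<psi> :: "'b \<Rightarrow> 'j" and k :: "'i \<times> 'j \<Rightarrow> real"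
  assumes M: "prob_space M" and N: "prob_space N"
    and \<phi>: "simple_function M \<phi>" and \<psi>: "simple_function N \<psi>"
    and k: "\<And>z. 0 \<le> k z \<and> k z \<le> C" and e: "e > 0"
  obtains P f g where "P \<in> couplings M N"
    "f \<in> borel_measurable M" "\<And>x. 0 \<le> f x \<and> f x \<le> C"
    "g \<in> borel_measurable N" "\<And>y. 0 \<le> g y \<and> g y \<le> C"
    "\<And>x y. x \<in> space M \<Longrightarrow> y \<in> space N \<Longrightarrow> k (\<phi> x, \<psi> y) \<le> f x + g y"
    "integral\<^sup>L M f + integral\<^sup>L N g \<le> (\<integral>z. k (\<phi> (fst z), \<psi> (snd z)) \<partial>P) + e"
proof -
  interpret M: prob_space M by fact
  interpret N: prob_space N by fact
  define S where "S i = \<phi> -` {i} \<inter> space M" for i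
  define T where "T j = \<psi> -` {j} \<inter> space N" for j
  define I where "I = {i\<in>\<phi> ` space M. 0 < M.prob (S i)}"
  define J where "J = {j\<in>\<psi> ` space N. 0 < N.prob (T j)}"
  have I: "finite I" "(\<Sum>i\<in>I. M.prob (S i)) = 1"
    using M.sum_prob_positive_fibres[OF \<phi>] by (auto simp: I_def S_def)
  have J: "finite J" "(\<Sum>j\<in>J. N.prob (T j)) = 1"
    using N.sum_prob_positive_fibres[OF \<psi>] by (auto simp: J_def T_def)
  have pos: "\<And>i. i \<in> I \<Longrightarrow> 0 < M.prob (S i)" "\<And>j. j \<in> J \<Longrightarrow> 0 < N.prob (T j)"
    by (auto simp: I_def J_def)
  obtain w u v where w: "\<And>z. z \<in> I \<times> J \<Longrightarrow> 0 < w z"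
      "\<And>i. i \<in> I \<Longrightarrow> (\<Sum>j\<in>J. w (i, j)) = M.prob (S i)" "\<And>j. j \<in> J \<Longrightarrow> (\<Sum>i\<in>I. w (i, j)) = N.prob (T j)"
    and u: "\<And>i. i \<in> I \<Longrightarrow> 0 \<le> u i \<and> u i \<le> C" and v: "\<And>j. j \<in> J \<Longrightarrow> 0 \<le> v j \<and> v j \<le> C"
    and uv: "\<And>i j. i \<in> I \<Longrightarrow> j \<in> J \<Longrightarrow> k (i, j) \<le> u i + v j"
    and le: "(\<Sum>i\<in>I. u i * M.prob (S i)) + (\<Sum>j\<in>J. v j * N.prob (T j)) \<le> (\<Sum>z\<in>I \<times> J. k z * w z) + e"
    using finite_transport_duality[OF I(1) J(1) pos I(2) J(2) _ e, of k C] k by blast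
  have ST: "\<And>i. S i \<in> sets M" "\<And>j. T j \<in> sets N" "disjoint_family_on S I" "disjoint_family_on T J"
    unfolding S_def T_def using simple_functionD(2)[OF \<phi>] simple_functionD(2)[OF \<psi>]
    by (auto simp: disjoint_family_on_def)
  obtain P where P: "P \<in> couplings M N" "\<And>i j. i \<in> I \<Longrightarrow> j \<in> J \<Longrightarrow> measure P (S i \<times> T j) = w (i, j)"
    by (rule coupling_of_weights[OF M N I(1) J(1) ST(1) ST(3) pos(1) I(2) ST(2) ST(4) pos(2) J(2), of w])
      (use w in \<open>auto simp: less_imp_le\<close>)
  interpret P: prob_space P using P(1) by (simp add: couplings_def)
  have sP[measurable_cong]: "sets P = sets (M \<Otimes>\<^sub>M N)" using P(1) by (simp add: couplings_def)
  have spP: "space P = space M \<times> space N"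
    using sets_eq_imp_space_eq[OF sP] by (simp add: space_pair_measure)
  have C: "0 \<le> C" using k[of undefined] by linarith
  \<comment> \<open>On null fibres, of which the finite problem knows nothing, the value
    \<open>C\<close> secures the inequality pointwise at no cost in the integral.\<close>
  define f where "f x = (if \<phi> x \<in> I then u (\<phi> x) else C)" for x
  define g where "g y = (if \<psi> y \<in> J then v (\<psi> y) else C)" for y
  have \<phi>m: "\<phi> \<in> M \<rightarrow>\<^sub>M count_space UNIV" and \<psi>m: "\<psi> \<in> N \<rightarrow>\<^sub>M count_space UNIV"
    using \<phi> \<psi> by (auto intro: measurable_simple_function)
  define \<theta> where "\<theta> z = (\<phi> (fst z), \<psi> (snd z))" for z
  \<comment> \<open>A pair of measurable maps into discrete spaces need not be measurable into the
    discrete product. For simple functions it is, which makes \<open>\<theta>\<close>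
    measurable.\<close>
  have "simple_function P (\<lambda>z. \<phi> (fst z))" "simple_function P (\<lambda>z. \<psi> (snd z))"
    unfolding simple_function_eq_measurable
    using \<phi>m \<psi>m finite_subset[OF _ simple_functionD(1)[OF \<phi>]] finite_subset[OF _ simple_functionD(1)[OF \<psi>]]
    by (auto simp: spP image_subset_iff intro: measurable_compose[OF _ \<phi>m] measurable_compose[OF _ \<psi>m])
  then have \<theta>: "\<theta> \<in> P \<rightarrow>\<^sub>M count_space UNIV"
    unfolding \<theta>_def by (intro measurable_simple_function simple_function_Pair)
  have w\<theta>: "P.prob (\<theta> -` {z} \<inter> space P) = w z" if "z \<in> I \<times> J" for z
  proof -
    have "\<theta> -` {z} \<inter> space P = S (fst z) \<times> T (snd z)"
      by (auto simp: \<theta>_def spP S_def T_def)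
    then show ?thesis using P(2)[of "fst z" "snd z"] that by auto
  qed
  have one: "(\<Sum>z\<in>I \<times> J. P.prob (\<theta> -` {z} \<inter> space P)) = 1"
    using w\<theta> w(2) I(2) by (simp add: sum.cartesian_product' cong: sum.cong)
  show ?thesis
  proof (rule that[of P f g])
    show "f \<in> borel_measurable M" unfolding f_def by (rule measurable_compose[OF \<phi>m]) simp
    show "g \<in> borel_measurable N" unfolding g_def by (rule measurable_compose[OF \<psi>m]) simp
    show "0 \<le> f x \<and> f x \<le> C" for x using u C by (simp add: f_def)
    show "0 \<le> g y \<and> g y \<le> C" for y using v C by (simp add: g_def)
    then show "k (\<phi> x, \<psi> y) \<le> f x + g y" for x y
      using \<open>\<And>x. 0 \<le> f x \<and> f x \<le> C\<close>[of x] k[of "(\<phi> x, \<psi> y)"] uv[of "\<phi> x" "\<psi> y"]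
      unfolding f_def g_def by (smt (verit))
    have "integral\<^sup>L M f = (\<Sum>i\<in>I. u i * M.prob (S i))"
      unfolding f_def S_def using M.integral_finite_range(1)[OF I(1) \<phi>m, of "\<lambda>i. if i \<in> I then u i else C"] I(2)
      by (simp add: S_def cong: sum.cong)
    moreover have "integral\<^sup>L N g = (\<Sum>j\<in>J. v j * N.prob (T j))"
      unfolding g_def T_def using N.integral_finite_range(1)[OF J(1) \<psi>m, of "\<lambda>j. if j \<in> J then v j else C"] J(2)
      by (simp add: T_def cong: sum.cong)
    moreover have "(\<integral>z. k (\<theta> z) \<partial>P) = (\<Sum>z\<in>I \<times> J. k z * w z)"
      using P.integral_finite_range(1)[OF _ \<theta> one, of k] I(1) J(1) w\<theta> by (simp cong: sum.cong)
    ultimately show "integral\<^sup>L M f + integral\<^sup>L N g \<le> (\<integral>z. k (\<phi> (fst z), \<psi> (snd z)) \<partial>P) + e"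
      using le by (simp add: \<theta>_def)
  qed (use P in auto)
qed

section \<open>Limits of bounded potentials\<close>

lemma (in prob_space) integrable_between:
  fixes f :: "'a \<Rightarrow> real"
  assumes "f \<in> borel_measurable M" "\<And>x. 0 \<le> f x \<and> f x \<le> C"
  shows "integrable M f"
  using assms by (intro integrable_const_bound[of f C]) auto

text \<open>On a probability space closeness in the square mean implies closeness in the mean, and
  sequences that are Cauchy in the mean have almost everywhere Cauchy subsequences.\<close>

lemma (in prob_space) L2_Cauchy_AE_Cauchy_subseq:
  fixes s :: "nat \<Rightarrow> 'a \<Rightarrow> real"
  assumes s[measurable]: "\<And>n. s n \<in> borel_measurable M" and bd: "\<And>n x. 0 \<le> s n x \<and> s n x \<le> C"
    and Cauchy: "\<And>e. e > 0 \<Longrightarrow> \<exists>N. \<forall>i\<ge>N. \<forall>j\<ge>N. (\<integral>x. (s i x - s j x)\<^sup>2 \<partial>M) < e"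
  obtains r where "strict_mono r" "AE x in M. Cauchy (\<lambda>i. s (r i) x)"
proof (rule cauchy_L1_AE_cauchy_subseq[of M s])
  show "integrable M (s n)" for n using s bd by (rule integrable_between)
  fix e :: real assume e: "e > 0"
  obtain N where N: "\<And>i j. i \<ge> N \<Longrightarrow> j \<ge> N \<Longrightarrow> (\<integral>x. (s i x - s j x)\<^sup>2 \<partial>M) < e\<^sup>2"
    using Cauchy[of "e\<^sup>2"] e by auto
  have "(\<integral>x. norm (s i x - s j x) \<partial>M) < e" if "i \<ge> N" "j \<ge> N" for i j
  proof -
    have dif: "\<bar>s i x - s j x\<bar> \<le> C" for x using bd[of i x] bd[of j x] by linarith
    then have "(s i x - s j x)\<^sup>2 \<le> C\<^sup>2" for x by (metis abs_ge_zero power2_abs power_mono)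
    then have i2: "integrable M (\<lambda>x. (s i x - s j x)\<^sup>2)"
      by (intro integrable_between[of _ "C\<^sup>2"]) auto
    \<comment> \<open>Young's inequality, that is
      \<open>(e - \<bar>s i x - s j x\<bar>)\<^sup>2 \<ge> 0\<close>. As the square mean is below
      \<open>e\<^sup>2\<close>, the two halves add up to less than \<open>e\<close>.\<close>
    have "(\<integral>x. norm (s i x - s j x) \<partial>M) \<le> (\<integral>x. e / 2 + (s i x - s j x)\<^sup>2 / (2 * e) \<partial>M)"
    proof (rule integral_mono)
      show "integrable M (\<lambda>x. norm (s i x - s j x))"
        using dif by (intro integrable_between[of _ C]) auto
      show "integrable M (\<lambda>x. e / 2 + (s i x - s j x)\<^sup>2 / (2 * e))" using i2 by simp
      show "norm (s i x - s j x) \<le> e / 2 + (s i x - s j x)\<^sup>2 / (2 * e)" for x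
      proof -
        have "0 \<le> (e - \<bar>s i x - s j x\<bar>)\<^sup>2" by simp
        then have "\<bar>s i x - s j x\<bar> * (2 * e) \<le> e\<^sup>2 + (s i x - s j x)\<^sup>2"
          by (simp add: power2_diff mult.commute mult.left_commute)
        then have "\<bar>s i x - s j x\<bar> \<le> (e\<^sup>2 + (s i x - s j x)\<^sup>2) / (2 * e)"
          using e by (simp add: pos_le_divide_eq)
        then show ?thesis using e by (simp add: add_divide_distrib power2_eq_square)
      qed
    qed
    also have "\<dots> = e / 2 + (\<integral>x. (s i x - s j x)\<^sup>2 \<partial>M) / (2 * e)"
      using i2 by (simp add: prob_space)
    also have "\<dots> < e / 2 + e\<^sup>2 / (2 * e)"
      using N[OF that] e by (intro add_strict_left_mono divide_strict_right_mono) auto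
    also have "\<dots> = e" using e by (simp add: power2_eq_square)
    finally show ?thesis .
  qed
  then show "\<exists>N. \<forall>i\<ge>N. \<forall>j\<ge>N. (\<integral>x. norm (s i x - s j x) \<partial>M) < e" by blast
qed (use that in blast)

text \<open>The alternative \<open>F x = C\<close> is recorded at every single point, since an
  almost everywhere statement would not yield a dual inequality that holds everywhere.\<close>

lemma (in prob_space) AE_Cauchy_bounded_limit:
  fixes s :: "nat \<Rightarrow> 'a \<Rightarrow> real"
  assumes s[measurable]: "\<And>n. s n \<in> borel_measurable M" and bd: "\<And>n x. 0 \<le> s n x \<and> s n x \<le> C"
    and ae: "AE x in M. Cauchy (\<lambda>n. s n x)"
  obtains F where "F \<in> borel_measurable M" "\<And>x. 0 \<le> F x \<and> F x \<le> C"
    "\<And>x. x \<in> space M \<Longrightarrow> F x = C \<or> (\<lambda>n. s n x) \<longlonglongrightarrow> F x"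
    "(\<lambda>n. integral\<^sup>L M (s n)) \<longlonglongrightarrow> integral\<^sup>L M F"
proof -
  define F where "F x = (if Cauchy (\<lambda>n. s n x) then lim (\<lambda>n. s n x) else C)" for x
  have F[measurable]: "F \<in> borel_measurable M" unfolding F_def by measurable
  have C: "0 \<le> C" using bd[of 0 undefined] by linarith
  have lim: "(\<lambda>n. s n x) \<longlonglongrightarrow> F x" if "Cauchy (\<lambda>n. s n x)" for x
    using that by (simp add: F_def Cauchy_convergent_iff convergent_LIMSEQ_iff)
  have F01: "0 \<le> F x \<and> F x \<le> C" for x
  proof (cases "Cauchy (\<lambda>n. s n x)")
    case True
    show ?thesis
      using LIMSEQ_le_const[OF lim[OF True], of 0] LIMSEQ_le_const2[OF lim[OF True], of C] bd by blast
  next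
    case False
    then show ?thesis using C by (simp add: F_def)
  qed
  moreover have "F x = C \<or> (\<lambda>n. s n x) \<longlonglongrightarrow> F x" for x
    using lim[of x] by (auto simp: F_def)
  moreover have "(\<lambda>n. integral\<^sup>L M (s n)) \<longlonglongrightarrow> integral\<^sup>L M F"
  proof (rule integral_dominated_convergence[where w = "\<lambda>_. C"])
    show "AE x in M. (\<lambda>n. s n x) \<longlonglongrightarrow> F x" using ae by eventually_elim (rule lim)
  qed (use bd in auto)
  ultimately show ?thesis using that[OF F] by blast
qed

text \<open>Dual potentials for \<open>c n\<close> need not converge. As in the proof of the projection theorem in
  a Hilbert space, those of almost minimal \<open>L\<^sup>2\<close> norm do, because the feasible sets
  are convex and decrease with \<open>n\<close>.\<close>

lemma dual_increasing_limit:
  fixes c :: "nat \<Rightarrow> 'a \<times> 'b \<Rightarrow> real"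
  assumes M: "prob_space M" and N: "prob_space N"
    and inc: "\<And>z. incseq (\<lambda>n. c n z)" and cC: "\<And>z. c' z \<le> C" and c': "\<And>z. (\<lambda>n. c n z) \<longlonglongrightarrow> c' z"
    and dual: "\<And>n e. e > 0 \<Longrightarrow> \<exists>f g. f \<in> borel_measurable M \<and> (\<forall>x. 0 \<le> f x \<and> f x \<le> C) \<and>
        g \<in> borel_measurable N \<and> (\<forall>y. 0 \<le> g y \<and> g y \<le> C) \<and>
        (\<forall>x\<in>space M. \<forall>y\<in>space N. c n (x, y) \<le> f x + g y) \<and>
        integral\<^sup>L M f + integral\<^sup>L N g \<le> s + e"
  obtains F G where "F \<in> borel_measurable M" "\<And>x. 0 \<le> F x \<and> F x \<le> C"
    "G \<in> borel_measurable N" "\<And>y. 0 \<le> G y \<and> G y \<le> C"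
    "\<And>x y. x \<in> space M \<Longrightarrow> y \<in> space N \<Longrightarrow> c' (x, y) \<le> F x + G y"
    "integral\<^sup>L M F + integral\<^sup>L N G \<le> s"
proof -
  interpret M: prob_space M by fact
  interpret N: prob_space N by fact
  define BN where "BN = {g. g \<in> borel_measurable N \<and> (\<forall>x. 0 \<le> g x \<and> g x \<le> C)}"
  define BM where "BM = {f. f \<in> borel_measurable M \<and> (\<forall>x. 0 \<le> f x \<and> f x \<le> C)}"
  \<comment> \<open>Bounding the dual value inside \<open>K n\<close> keeps the set convex. The
    slack \<open>1 / real (Suc n)\<close> makes it nonempty, and since the slack decreases, the sets
    decrease and the value of a limit is at most \<open>s\<close>.\<close>
  define K where "K n = {(f, g). f \<in> BM \<and> g \<in> BN \<and> (\<forall>x\<in>space M. \<forall>y\<in>space N. c n (x, y) \<le> f x + g y) \<and>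
      integral\<^sup>L M f + integral\<^sup>L N g \<le> s + 1 / real (Suc n)}" for n
  define Q where "Q = (\<lambda>(f :: 'a \<Rightarrow> real, g :: 'b \<Rightarrow> real). (\<integral>x. (f x)\<^sup>2 \<partial>M) + (\<integral>y. (g y)\<^sup>2 \<partial>N) :: real)"
  define d where "d n = Inf (Q ` K n)" for n
  have Kne: "K n \<noteq> {}" for n
    using dual[of "1 / real (Suc n)" n] by (auto simp: K_def BM_def BN_def)
  have Kdec: "K m \<subseteq> K n" if "n \<le> m" for n m
  proof -
    have "1 / real (Suc m) \<le> 1 / real (Suc n)" using that by (simp add: frac_le)
    moreover have "c n z \<le> c m z" for z using inc that by (rule incseqD)
    ultimately show ?thesis unfolding K_def
      by (auto simp del: of_nat_Suc) (meson order_trans)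
  qed
  have sqC: "(t :: real)\<^sup>2 \<le> C\<^sup>2" if "0 \<le> t \<and> t \<le> C" for t using that by (simp add: power_mono)
  have intM: "integrable M f" "integrable M (\<lambda>x. (f x)\<^sup>2)" "(\<integral>x. (f x)\<^sup>2 \<partial>M) \<le> C\<^sup>2" if "f \<in> BM" for f
  proof -
    have fm: "f \<in> borel_measurable M" and fb: "\<And>x. 0 \<le> f x \<and> f x \<le> C" using that by (auto simp: BM_def)
    show "integrable M f" using fm fb by (rule M.integrable_between)
    show i: "integrable M (\<lambda>x. (f x)\<^sup>2)" using fm sqC[OF fb] by (intro M.integrable_between[of _ "C\<^sup>2"]) auto
    show "(\<integral>x. (f x)\<^sup>2 \<partial>M) \<le> C\<^sup>2" using i sqC[OF fb] by (intro M.integral_le_const) auto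
  qed
  have intN: "integrable N f" "integrable N (\<lambda>x. (f x)\<^sup>2)" "(\<integral>x. (f x)\<^sup>2 \<partial>N) \<le> C\<^sup>2" if "f \<in> BN" for f
  proof -
    have fm: "f \<in> borel_measurable N" and fb: "\<And>x. 0 \<le> f x \<and> f x \<le> C" using that by (auto simp: BN_def)
    show "integrable N f" using fm fb by (rule N.integrable_between)
    show i: "integrable N (\<lambda>x. (f x)\<^sup>2)" using fm sqC[OF fb] by (intro N.integrable_between[of _ "C\<^sup>2"]) auto
    show "(\<integral>x. (f x)\<^sup>2 \<partial>N) \<le> C\<^sup>2" using i sqC[OF fb] by (intro N.integral_le_const) auto
  qed
  have Q0: "0 \<le> Q z" for z by (auto simp: Q_def split: prod.split)
  have bdd: "bdd_below (Q ` K n)" for n using Q0 by (intro bdd_belowI[of _ 0]) auto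
  have Qle: "Q z \<le> 2 * C\<^sup>2" if "z \<in> K n" for z n
    using that intM(3) intN(3) unfolding K_def Q_def by fastforce
  have dle: "d n \<le> Q z" if "z \<in> K n" for z n
    unfolding d_def using that bdd by (intro cInf_lower) auto
  \<comment> \<open>Infima over shrinking sets increase; bounded by \<open>2 * C\<^sup>2\<close>,
    they converge, and this makes the right-hand side of \<open>par\<close> small.\<close>
  have dinc: "incseq d"
    unfolding incseq_def d_def using Kne bdd
    by (intro allI impI cInf_superset_mono image_mono Kdec) auto
  have dbd: "d n \<le> 2 * C\<^sup>2" for n
    using Kne[of n] dle Qle by (meson all_not_in_conv order_trans)
  have dconv: "convergent d"
    using incseq_convergent[OF dinc] dbd by (metis convergentI)
  have "\<exists>z. z \<in> K n \<and> Q z \<le> d n + 1 / real (Suc n)" for n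
  proof -
    have "Inf (Q ` K n) < d n + 1 / real (Suc n)" unfolding d_def by simp
    then show ?thesis using Kne[of n] bdd[of n] by (subst (asm) cInf_less_iff) (auto intro: less_imp_le)
  qed
  then obtain z where z: "\<And>n. z n \<in> K n" "\<And>n. Q (z n) \<le> d n + 1 / real (Suc n)" by metis
  define f where "f n = fst (z n)" for n
  define g where "g n = snd (z n)" for n
  have fg: "(f n, g n) \<in> K n" "Q (f n, g n) \<le> d n + 1 / real (Suc n)" for n
    using z by (auto simp: f_def g_def)
  have fB: "f n \<in> BM" "g n \<in> BN" for n using fg(1)[of n] by (auto simp: K_def)
  \<comment> \<open>Parallelogram identity. The midpoint of the pairs with indices \<open>i\<close>
    and \<open>j\<close> lies in the convex set \<open>K i\<close>, so its \<open>Q\<close> is at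
    least \<open>d i\<close>; both pairs miss their infima by at most
    \<open>1 / real (Suc i)\<close>.\<close>
  have par: "(\<integral>x. (f i x - f j x)\<^sup>2 \<partial>M) + (\<integral>y. (g i y - g j y)\<^sup>2 \<partial>N)
      \<le> 2 * (d j - d i) + 4 / real (Suc i)" if "i \<le> j" for i j
  proof -
    have fj: "(f j, g j) \<in> K i" using fg(1) Kdec[OF that] by blast
    define u where "u x = (f i x + f j x) / 2" for x
    define v where "v y = (g i y + g j y) / 2" for y
    have mid: "a + b \<le> C * 2" if "a \<le> C" "b \<le> C" for a b
      using that by simp
    have uB: "u \<in> BM" "v \<in> BN"
      using fB[of i] fB[of j] unfolding BM_def BN_def u_def[abs_def] v_def[abs_def]
      by (auto intro!: mid)
    have "integral\<^sup>L M u = (integral\<^sup>L M (f i) + integral\<^sup>L M (f j)) / 2"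
      "integral\<^sup>L N v = (integral\<^sup>L N (g i) + integral\<^sup>L N (g j)) / 2"
      unfolding u_def v_def using fB intM(1) intN(1) by simp_all
    moreover have "c i (x, y) \<le> u x + v y" if "x \<in> space M" "y \<in> space N" for x y
    proof -
      have "c i (x, y) \<le> f i x + g i y" "c i (x, y) \<le> f j x + g j y"
        using fg(1)[of i] fj that by (auto simp: K_def)
      then show ?thesis unfolding u_def v_def by (simp add: field_simps)
    qed
    moreover have "integral\<^sup>L M (f i) + integral\<^sup>L N (g i) \<le> s + 1 / real (Suc i)"
      "integral\<^sup>L M (f j) + integral\<^sup>L N (g j) \<le> s + 1 / real (Suc i)"
      using fg(1)[of i] fj by (simp_all add: K_def)
    moreover have "(a + a') / 2 + (b + b') / 2 \<le> t" if "a + b \<le> t" "a' + b' \<le> t" for a a' b b' t :: real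
      using that by argo
    ultimately have "(u, v) \<in> K i"
      using uB unfolding K_def by (simp del: of_nat_Suc add_divide_distrib)
    then have 1: "d i \<le> Q (u, v)" by (rule dle)
    have sq: "(a - b)\<^sup>2 = 2 * a\<^sup>2 + 2 * b\<^sup>2 - 4 * ((a + b) / 2)\<^sup>2" for a b :: real
      by (simp add: power2_eq_square field_simps)
    have "(\<integral>x. (f i x - f j x)\<^sup>2 \<partial>M) = (\<integral>x. 2 * (f i x)\<^sup>2 + 2 * (f j x)\<^sup>2 - 4 * (u x)\<^sup>2 \<partial>M)"
      unfolding u_def sq ..
    also have "\<dots> = 2 * (\<integral>x. (f i x)\<^sup>2 \<partial>M) + 2 * (\<integral>x. (f j x)\<^sup>2 \<partial>M) - 4 * (\<integral>x. (u x)\<^sup>2 \<partial>M)"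
      using intM(2)[OF fB(1)] intM(2)[OF uB(1)] by simp
    finally have 2: "(\<integral>x. (f i x - f j x)\<^sup>2 \<partial>M) = 2 * (\<integral>x. (f i x)\<^sup>2 \<partial>M) + 2 * (\<integral>x. (f j x)\<^sup>2 \<partial>M) - 4 * (\<integral>x. (u x)\<^sup>2 \<partial>M)" .
    have "(\<integral>x. (g i x - g j x)\<^sup>2 \<partial>N) = (\<integral>x. 2 * (g i x)\<^sup>2 + 2 * (g j x)\<^sup>2 - 4 * (v x)\<^sup>2 \<partial>N)"
      unfolding v_def sq ..
    also have "\<dots> = 2 * (\<integral>x. (g i x)\<^sup>2 \<partial>N) + 2 * (\<integral>x. (g j x)\<^sup>2 \<partial>N) - 4 * (\<integral>x. (v x)\<^sup>2 \<partial>N)"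
      using intN(2)[OF fB(2)] intN(2)[OF uB(2)] by simp
    finally have 3: "(\<integral>x. (g i x - g j x)\<^sup>2 \<partial>N) = 2 * (\<integral>x. (g i x)\<^sup>2 \<partial>N) + 2 * (\<integral>x. (g j x)\<^sup>2 \<partial>N) - 4 * (\<integral>x. (v x)\<^sup>2 \<partial>N)" .
    define t where "t = 1 / real (Suc i)"
    have "1 / real (Suc j) \<le> t" using that by (simp add: t_def frac_le)
    then have "Q (f i, g i) \<le> d i + t" "Q (f j, g j) \<le> d j + t"
      using fg(2)[of i] fg(2)[of j] unfolding t_def by linarith+
    moreover have "4 / real (Suc i) = 4 * t" by (simp add: t_def)
    ultimately show ?thesis
      unfolding 2 3 using 1 by (simp add: Q_def del: of_nat_Suc)
  qed
  have small: "\<exists>n. \<forall>i\<ge>n. \<forall>j\<ge>n. (\<integral>x. (f i x - f j x)\<^sup>2 \<partial>M) + (\<integral>y. (g i y - g j y)\<^sup>2 \<partial>N) < e"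
    if e: "e > 0" for e
  proof -
    have "Cauchy d" using dconv by (rule convergent_Cauchy)
    then obtain n1 where n1: "\<And>i j. i \<ge> n1 \<Longrightarrow> j \<ge> n1 \<Longrightarrow> \<bar>d i - d j\<bar> < e / 4"
      using e unfolding Cauchy_def dist_real_def by (metis divide_pos_pos zero_less_numeral)
    obtain n2 where n2: "1 / real (Suc n2) < e / 8" using e by (metis nat_approx_posE divide_pos_pos zero_less_numeral)
    have A: "(\<integral>x. (f i x - f j x)\<^sup>2 \<partial>M) + (\<integral>y. (g i y - g j y)\<^sup>2 \<partial>N) < e"
      if "max n1 n2 \<le> i" "i \<le> j" for i j
    proof -
      have "1 / real (Suc i) \<le> 1 / real (Suc n2)" using that by (simp add: frac_le)
      then have "4 / real (Suc i) < e / 2" using n2 by simp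
      moreover have "\<bar>d j - d i\<bar> < e / 4" using n1[of j i] that by auto
      then have "d j - d i < e / 4" by linarith
      then have "2 * (d j - d i) < e / 2" by argo
      ultimately have "2 * (d j - d i) + 4 / real (Suc i) < e / 2 + e / 2" by (rule add_strict_mono[rotated])
      then show ?thesis using par[OF that(2)] by (simp del: of_nat_Suc)
    qed
    have "(\<integral>x. (f i x - f j x)\<^sup>2 \<partial>M) + (\<integral>y. (g i y - g j y)\<^sup>2 \<partial>N) < e"
      if "max n1 n2 \<le> i" "max n1 n2 \<le> j" for i j
    proof (cases "i \<le> j")
      case True
      then show ?thesis using A that by blast
    next
      case False
      have "(\<integral>x. (f j x - f i x)\<^sup>2 \<partial>M) + (\<integral>y. (g j y - g i y)\<^sup>2 \<partial>N) < e"
        using A False that by simp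
      then show ?thesis by (simp only: power2_commute)
    qed
    then show ?thesis by blast
  qed
  have fm: "\<And>n. f n \<in> borel_measurable M" "\<And>n x. 0 \<le> f n x \<and> f n x \<le> C"
    and gm: "\<And>n. g n \<in> borel_measurable N" "\<And>n x. 0 \<le> g n x \<and> g n x \<le> C"
    using fB by (auto simp: BM_def BN_def)
  have nn: "0 \<le> (\<integral>x. (f i x - f j x)\<^sup>2 \<partial>M)" "0 \<le> (\<integral>y. (g i y - g j y)\<^sup>2 \<partial>N)" for i j
    by simp_all
  have smallf: "\<exists>n. \<forall>i\<ge>n. \<forall>j\<ge>n. (\<integral>x. (f i x - f j x)\<^sup>2 \<partial>M) < e" if e: "e > 0" for e
  proof -
    obtain n where n: "\<And>i j. n \<le> i \<Longrightarrow> n \<le> j \<Longrightarrow>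
        (\<integral>x. (f i x - f j x)\<^sup>2 \<partial>M) + (\<integral>y. (g i y - g j y)\<^sup>2 \<partial>N) < e"
      using small[OF e] by blast
    have "(\<integral>x. (f i x - f j x)\<^sup>2 \<partial>M) < e" if "n \<le> i" "n \<le> j" for i j
      using n[OF that] nn(2)[of i j] by linarith
    then show ?thesis by blast
  qed
  obtain r where r: "strict_mono r" "AE x in M. Cauchy (\<lambda>i. f (r i) x)"
    by (rule M.L2_Cauchy_AE_Cauchy_subseq[of f C, OF fm smallf])
  have smallg: "\<exists>n. \<forall>i\<ge>n. \<forall>j\<ge>n. (\<integral>x. (g (r i) x - g (r j) x)\<^sup>2 \<partial>N) < e" if e: "e > 0" for e
  proof -
    obtain n where n: "\<And>i j. n \<le> i \<Longrightarrow> n \<le> j \<Longrightarrow>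
        (\<integral>x. (f i x - f j x)\<^sup>2 \<partial>M) + (\<integral>y. (g i y - g j y)\<^sup>2 \<partial>N) < e"
      using small[OF e] by blast
    have "(\<integral>x. (g (r i) x - g (r j) x)\<^sup>2 \<partial>N) < e" if "n \<le> i" "n \<le> j" for i j
    proof -
      have "n \<le> r i" "n \<le> r j" using seq_suble[OF r(1)] that by (meson order_trans)+
      then show ?thesis using n[of "r i" "r j"] nn(1)[of "r i" "r j"] by linarith
    qed
    then show ?thesis by blast
  qed
  obtain r' where r': "strict_mono r'" "AE y in N. Cauchy (\<lambda>i. g (r (r' i)) y)"
    by (rule N.L2_Cauchy_AE_Cauchy_subseq[of "\<lambda>i. g (r i)" C, OF gm smallg])
  \<comment> \<open>Refining \<open>r\<close> by \<open>r'\<close> makes both families Cauchy almost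
    everywhere along one index sequence. The bound \<open>i \<le> \<rho> i\<close> passes domination
    of \<open>c n\<close> and the slack of index \<open>n\<close> on to the subsequence.\<close>
  define \<rho> where "\<rho> i = r (r' i)" for i
  have \<rho>: "i \<le> \<rho> i" for i
    unfolding \<rho>_def using seq_suble[OF r(1)] seq_suble[OF r'(1)] by (meson order_trans)
  have aef: "AE x in M. Cauchy (\<lambda>i. f (\<rho> i) x)"
    using r(2)
  proof eventually_elim
    fix x assume "Cauchy (\<lambda>i. f (r i) x)"
    from Cauchy_subseq_Cauchy[OF this r'(1)] show "Cauchy (\<lambda>i. f (\<rho> i) x)" by (simp add: \<rho>_def comp_def)
  qed
  obtain F where F: "F \<in> borel_measurable M" "\<And>x. 0 \<le> F x \<and> F x \<le> C"
    "\<And>x. x \<in> space M \<Longrightarrow> F x = C \<or> (\<lambda>n. f (\<rho> n) x) \<longlonglongrightarrow> F x"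
    "(\<lambda>n. integral\<^sup>L M (f (\<rho> n))) \<longlonglongrightarrow> integral\<^sup>L M F"
    by (rule M.AE_Cauchy_bounded_limit[of "\<lambda>n. f (\<rho> n)" C, OF fm aef]) blast
  have aeg: "AE y in N. Cauchy (\<lambda>i. g (\<rho> i) y)" using r'(2) by (simp add: \<rho>_def)
  obtain G where G: "G \<in> borel_measurable N" "\<And>x. 0 \<le> G x \<and> G x \<le> C"
    "\<And>x. x \<in> space N \<Longrightarrow> G x = C \<or> (\<lambda>n. g (\<rho> n) x) \<longlonglongrightarrow> G x"
    "(\<lambda>n. integral\<^sup>L N (g (\<rho> n))) \<longlonglongrightarrow> integral\<^sup>L N G"
    by (rule N.AE_Cauchy_bounded_limit[of "\<lambda>n. g (\<rho> n)" C, OF gm aeg]) blast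
  show ?thesis
  proof (rule that[OF F(1,2) G(1,2)])
    fix x y assume xy: "x \<in> space M" "y \<in> space N"
    \<comment> \<open>If one potential equals \<open>C\<close>, it suffices alone. Otherwise both
      sequences converge at exactly these two points, and the inequality passes to the
      limit.\<close>
    show "c' (x, y) \<le> F x + G y"
    proof (cases "F x = C \<or> G y = C")
      case True
      then show ?thesis using F(2)[of x] G(2)[of y] cC[of "(x, y)"] by auto
    next
      case False
      then have "(\<lambda>n. f (\<rho> n) x + g (\<rho> n) y) \<longlonglongrightarrow> F x + G y"
        using F(3)[OF xy(1)] G(3)[OF xy(2)] by (intro tendsto_add) auto
      moreover have "c n (x, y) \<le> f (\<rho> n) x + g (\<rho> n) y" for n
        using fg(1)[of "\<rho> n"] xy incseqD[OF inc \<rho>, of n "(x, y)"] unfolding K_def by fastforce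
      ultimately show ?thesis by (intro LIMSEQ_le[OF c'[of "(x, y)"]]) auto
    qed
  next
    have "integral\<^sup>L M (f (\<rho> n)) + integral\<^sup>L N (g (\<rho> n)) \<le> s + 1 / real (Suc n)" for n
    proof -
      have "1 / real (Suc (\<rho> n)) \<le> 1 / real (Suc n)" using \<rho>[of n] by (simp add: frac_le)
      moreover have "integral\<^sup>L M (f (\<rho> n)) + integral\<^sup>L N (g (\<rho> n)) \<le> s + 1 / real (Suc (\<rho> n))"
        using fg(1)[of "\<rho> n"] by (simp add: K_def)
      ultimately show ?thesis by (meson add_left_mono order_trans)
    qed
    moreover have "(\<lambda>n. s + 1 / real (Suc n)) \<longlonglongrightarrow> s + 0"
      by (intro tendsto_add tendsto_const LIMSEQ_Suc lim_1_over_n)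
    ultimately show "integral\<^sup>L M F + integral\<^sup>L N G \<le> s"
      using LIMSEQ_le[OF tendsto_add[OF F(4) G(4)], of "\<lambda>n. s + 1 / real (Suc n)" "s + 0"] by auto
  qed
qed

section \<open>Suprema of countably many rectangle functions\<close>

text \<open>The maximum \<open>d n\<close> of the first rectangle functions sees a point only
  through the finite sets of indices \<open>j\<close> with \<open>x \<in> S j\<close> and with
  \<open>y \<in> T j\<close>, so step duality applies to it. Since \<open>d n \<le> c\<close>, the
  primal supremum \<open>s\<close> of \<open>c\<close> bounds the dual values for all
  \<open>n\<close> at once, as the passage to the limit requires.\<close>

lemma rectangle_sup_duality:
  fixes a :: "nat \<Rightarrow> real"
  assumes M: "prob_space M" and N: "prob_space N"
    and a: "\<And>j. 0 \<le> a j" and S: "\<And>j. S j \<in> sets M" and T: "\<And>j. T j \<in> sets N"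
    and ub: "\<And>j z. a j * indicator (S j \<times> T j) z \<le> c z" and lub: "\<And>z t. t < c z \<Longrightarrow> \<exists>j. t < a j * indicator (S j \<times> T j) z"
    and C: "\<And>z. c z \<le> C" and aC: "\<And>j. a j \<le> C" and e: "e > 0"
  obtains P F G where "P \<in> couplings M N" "integrable P c"
    "F \<in> borel_measurable M" "\<And>x. 0 \<le> F x \<and> F x \<le> C"
    "G \<in> borel_measurable N" "\<And>y. 0 \<le> G y \<and> G y \<le> C"
    "\<And>x y. x \<in> space M \<Longrightarrow> y \<in> space N \<Longrightarrow> c (x, y) \<le> F x + G y"
    "integral\<^sup>L M F + integral\<^sup>L N G \<le> integral\<^sup>L P c + e"
proof -
  define b where "b j z = a j * indicator (S j \<times> T j) z" for j z
  define d where "d n z = Max ((\<lambda>j. b j z) ` {..n})" for n z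
  have bd: "b j z \<le> d n z" if "j \<le> n" for j n z
    using that by (auto simp: d_def intro!: Max_ge)
  have dc: "d n z \<le> c z" for n z
    using ub by (auto simp: d_def b_def intro!: Max.boundedI)
  have d0: "0 \<le> d n z" for n z
    using bd[of 0 n z] a[of 0] by (auto simp: b_def intro: order_trans[rotated])
  have c0: "0 \<le> c z" for z using d0[of 0 z] dc[of 0 z] by linarith
  have inc: "incseq (\<lambda>n. d n z)" for z
    unfolding d_def by (intro incseq_SucI Max_mono) auto
  have lim: "(\<lambda>n. d n z) \<longlonglongrightarrow> c z" for z
  proof (rule increasing_tendsto)
    show "\<forall>\<^sub>F n in sequentially. d n z \<le> c z" using dc by simp
    fix t assume "t < c z"
    then obtain j where "t < b j z" using lub unfolding b_def by blast
    then show "\<forall>\<^sub>F n in sequentially. t < d n z"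
      using bd by (intro eventually_sequentiallyI[of j]) (meson less_le_trans)
  qed
  have dm: "d n \<in> borel_measurable (M \<Otimes>\<^sub>M N)" for n
  proof (induction n)
    case 0
    have "d 0 = b 0" by (auto simp: d_def)
    then show ?case using S T by (auto simp: b_def[abs_def] intro!: borel_measurable_times borel_measurable_indicator)
  next
    case (Suc n)
    have "d (Suc n) = (\<lambda>z. max (b (Suc n) z) (d n z))"
      by (auto simp: d_def atMost_Suc)
    moreover have "b (Suc n) \<in> borel_measurable (M \<Otimes>\<^sub>M N)"
      using S T by (auto simp: b_def[abs_def] intro!: borel_measurable_times borel_measurable_indicator)
    ultimately show ?case using Suc by (simp add: borel_measurable_max)
  qed
  have cm: "c \<in> borel_measurable (M \<Otimes>\<^sub>M N)"
    using lim dm by (rule borel_measurable_LIMSEQ_real)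
  have int: "integrable P h" if P: "P \<in> couplings M N" and h: "h \<in> borel_measurable (M \<Otimes>\<^sub>M N)" "\<And>z. 0 \<le> h z \<and> h z \<le> C" for P h
  proof -
    interpret P: prob_space P using P by (simp add: couplings_def)
    have sP: "sets P = sets (M \<Otimes>\<^sub>M N)" using P by (simp add: couplings_def)
    show ?thesis using h measurable_cong_sets[OF sP refl] by (intro P.integrable_between[of _ C]) auto
  qed
  have cint: "integrable P c" if "P \<in> couplings M N" for P
    using int[OF that cm] c0 C by blast
  have step: "\<exists>P f g. P \<in> couplings M N \<and> f \<in> borel_measurable M \<and> (\<forall>x. 0 \<le> f x \<and> f x \<le> C) \<and>
      g \<in> borel_measurable N \<and> (\<forall>y. 0 \<le> g y \<and> g y \<le> C) \<and>
      (\<forall>x\<in>space M. \<forall>y\<in>space N. d n (x, y) \<le> f x + g y) \<and>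
      integral\<^sup>L M f + integral\<^sup>L N g \<le> integral\<^sup>L P c + e" if e: "e > 0" for n e
  proof -
    \<comment> \<open>Membership patterns label the cells of the partition generated by the sets
      \<open>S j\<close> with \<open>j \<le> n\<close>, and those of its counterpart for
      \<open>T j\<close>.\<close>
    define \<phi> where "\<phi> x = {j\<in>{..n}. x \<in> S j}" for x
    define \<psi> where "\<psi> y = {j\<in>{..n}. y \<in> T j}" for y
    define k where "k z = Max ((\<lambda>j. a j * of_bool (j \<in> fst z \<and> j \<in> snd z)) ` {..n})" for z
    have kd: "k (\<phi> x, \<psi> y) = d n (x, y)" for x y
      unfolding k_def d_def b_def \<phi>_def \<psi>_def
      by (intro arg_cong[of _ _ Max] image_cong) (auto simp: indicator_def)
    have "a 0 * of_bool (0 \<in> fst z \<and> 0 \<in> snd z) \<le> k z" for z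
      unfolding k_def by (intro Max_ge) auto
    moreover have "0 \<le> a 0 * of_bool (0 \<in> fst z \<and> 0 \<in> snd z)" for z :: "nat set \<times> nat set"
      using a[of 0] by simp
    ultimately have k0: "0 \<le> k z" for z by (meson order_trans)
    have kC: "k z \<le> C" for z
      unfolding k_def using aC order_trans[OF a aC] by (subst Max_le_iff) auto
    have sf: "simple_function L (\<lambda>x. {j\<in>{..n}. x \<in> U j})" if "\<And>j. U j \<in> sets L" for L and U :: "nat \<Rightarrow> 'z set"
      unfolding simple_function_def
    proof (intro conjI ballI)
      show "finite ((\<lambda>x. {j\<in>{..n}. x \<in> U j}) ` space L)"
        by (rule finite_subset[of _ "Pow {..n}"]) auto
      fix B
      have "(\<lambda>x. {j\<in>{..n}. x \<in> U j}) -` {B} \<inter> space L =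
          (if B \<subseteq> {..n} then {x\<in>space L. \<forall>j\<in>{..n}. x \<in> U j \<longleftrightarrow> j \<in> B} else {})"
        by auto
      also have "\<dots> \<in> sets L"
      proof -
        note that[measurable]
        have "{x\<in>space L. \<forall>j\<in>{..n}. x \<in> U j \<longleftrightarrow> j \<in> B} \<in> sets L" by measurable
        then show ?thesis by simp
      qed
      finally show "(\<lambda>x. {j\<in>{..n}. x \<in> U j}) -` {B} \<inter> space L \<in> sets L" .
    qed
    have sf': "simple_function M \<phi>" "simple_function N \<psi>"
      unfolding \<phi>_def[abs_def] \<psi>_def[abs_def] using S T by (intro sf; blast)+
    have kk: "0 \<le> k z \<and> k z \<le> C" for z using k0 kC by blast
    obtain P f g where P: "P \<in> couplings M N"
      and fg: "f \<in> borel_measurable M" "\<And>x. 0 \<le> f x \<and> f x \<le> C"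
        "g \<in> borel_measurable N" "\<And>y. 0 \<le> g y \<and> g y \<le> C"
      and kfg: "\<And>x y. x \<in> space M \<Longrightarrow> y \<in> space N \<Longrightarrow> k (\<phi> x, \<psi> y) \<le> f x + g y"
      and le': "integral\<^sup>L M f + integral\<^sup>L N g \<le> (\<integral>z. k (\<phi> (fst z), \<psi> (snd z)) \<partial>P) + e"
      by (rule step_duality[where k = k, OF M N sf' kk e]) blast
    have fgd: "\<And>x y. x \<in> space M \<Longrightarrow> y \<in> space N \<Longrightarrow> d n (x, y) \<le> f x + g y"
      using kfg unfolding kd by blast
    have le: "integral\<^sup>L M f + integral\<^sup>L N g \<le> (\<integral>z. d n z \<partial>P) + e"
      using le' unfolding kd by simp
    have "integral\<^sup>L P (d n) \<le> integral\<^sup>L P c"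
    proof (rule integral_mono)
      show "integrable P (d n)" using d0 order_trans[OF dc C] by (intro int[OF P] dm) blast
    qed (use cint[OF P] dc in auto)
    then have "integral\<^sup>L M f + integral\<^sup>L N g \<le> integral\<^sup>L P c + e" using le by linarith
    then show ?thesis using P fg fgd by blast
  qed
  define s where "s = (SUP P\<in>couplings M N. integral\<^sup>L P c)"
  have bdd: "bdd_above ((\<lambda>P. integral\<^sup>L P c) ` couplings M N)"
  proof (rule bdd_aboveI2[where M = C])
    fix P assume P: "P \<in> couplings M N"
    interpret P: prob_space P using P by (simp add: couplings_def)
    show "integral\<^sup>L P c \<le> C" using cint[OF P] C by (intro P.integral_le_const) auto
  qed
  have le_s: "integral\<^sup>L P c \<le> s" if "P \<in> couplings M N" for P
    unfolding s_def using that bdd by (rule cSUP_upper)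
  have "\<exists>f g. f \<in> borel_measurable M \<and> (\<forall>x. 0 \<le> f x \<and> f x \<le> C) \<and>
      g \<in> borel_measurable N \<and> (\<forall>y. 0 \<le> g y \<and> g y \<le> C) \<and>
      (\<forall>x\<in>space M. \<forall>y\<in>space N. d n (x, y) \<le> f x + g y) \<and>
      integral\<^sup>L M f + integral\<^sup>L N g \<le> s + e" if "e > 0" for n e
    using step[OF that, of n] le_s by (meson add_right_mono order_trans)
  note dual = this
  obtain F G where FG: "F \<in> borel_measurable M" "\<And>x. 0 \<le> F x \<and> F x \<le> C"
    "G \<in> borel_measurable N" "\<And>y. 0 \<le> G y \<and> G y \<le> C"
    "\<And>x y. x \<in> space M \<Longrightarrow> y \<in> space N \<Longrightarrow> c (x, y) \<le> F x + G y"
    "integral\<^sup>L M F + integral\<^sup>L N G \<le> s"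
    by (rule dual_increasing_limit[OF M N inc C lim dual]) blast+
  \<comment> \<open>The dual value is at most \<open>s\<close> itself; all of \<open>e\<close> is
    spent on a coupling whose primal value exceeds \<open>s - e\<close>.\<close>
  have "couplings M N \<noteq> {}" using step[OF e] by blast
  then obtain P where P: "P \<in> couplings M N" "s - e < integral\<^sup>L P c"
    using less_cSUP_iff[OF _ bdd, of "s - e"] e unfolding s_def by auto
  show ?thesis
    using that[OF P(1) cint[OF P(1)] FG(1-5)] FG(6) P(2) by linarith
qed

section \<open>Bounded lower semicontinuous functions\<close>

text \<open>Measurability of the intersection is not enough for the step approximation, which needs
  the rectangles themselves. Countably many balls in the separable factor suffice, each paired with
  the largest open set that fits.\<close>

lemma open_Int_separable_rectangles:
  fixes U :: "('a::metric_space \<times> 'b::metric_space) set"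
  assumes U: "open U" and A: "A \<in> sets borel" and sep: "separable_space (top_of_set A)"
  shows "\<exists>S T :: nat \<Rightarrow> _. (\<forall>n. S n \<in> sets borel \<and> T n \<in> sets borel) \<and> U \<inter> (A \<times> UNIV) = (\<Union>n. S n \<times> T n)"
proof -
  obtain D where D: "countable D" "D \<subseteq> A" "(top_of_set A) closure_of D = A"
    using sep unfolding separable_space_def by auto
  show ?thesis
  proof (cases "D = {}")
    case True
    then have "A = {}" using D(3) by simp
    then show ?thesis by (intro exI[of _ "\<lambda>_. {}"]) auto
  next
    case False
    define x where "x = from_nat_into D"
    have x: "range x = D" using D(1) False by (simp add: x_def)
    have dense: "A \<subseteq> closure D"
      using D by (simp add: closure_of_subtopology inf.absorb2) blast
    \<comment> \<open>One natural number encodes both the index of a centre in \<open>D\<close> and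
      the radius.\<close>
    define r where "r n = 1 / real (Suc (snd (prod_decode n)))" for n
    define S where "S n = ball (x (fst (prod_decode n))) (r n)" for n
    \<comment> \<open>A union of possibly uncountably many open sets is still open, hence Borel, so
      nothing is asked of the second factor.\<close>
    define T where "T n = \<Union>{W. open W \<and> S n \<times> W \<subseteq> U}" for n
    have "\<exists>n. u \<in> S n \<and> v \<in> T n" if uv: "(u, v) \<in> U" "u \<in> A" for u v
    proof -
      obtain V W where VW: "open V" "open W" "(u, v) \<in> V \<times> W" "V \<times> W \<subseteq> U"
        using open_prod_elim[OF U uv(1)] by auto
      then obtain \<epsilon> where \<epsilon>: "\<epsilon> > 0" "ball u \<epsilon> \<subseteq> V" by (meson SigmaD1 openE)
      obtain m where m: "1 / real (Suc m) < \<epsilon> / 2" using \<epsilon> by (metis half_gt_zero nat_approx_posE)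
      obtain w where w: "w \<in> D" "dist w u < 1 / real (Suc m)"
        using dense uv(2) closure_approachable[of u D] by (auto dest!: spec[of _ "1 / real (Suc m)"])
      obtain i where i: "x i = w" using w(1) x by blast
      define n where "n = prod_encode (i, m)"
      have S: "S n = ball w (1 / real (Suc m))" by (simp add: S_def r_def n_def i)
      have "S n \<subseteq> ball u \<epsilon>"
      proof
        fix t assume "t \<in> S n"
        then have "dist w t < \<epsilon> / 2" "dist w u < \<epsilon> / 2" using w(2) m unfolding S by auto
        then have "dist u t < \<epsilon>" using dist_triangle_half_r by blast
        then show "t \<in> ball u \<epsilon>" by simp
      qed
      then have "v \<in> T n" using VW \<epsilon> unfolding T_def by blast
      moreover have "u \<in> S n" using w(2) by (simp add: S)
      ultimately show ?thesis by blast
    qed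
    then have "U \<inter> (A \<times> UNIV) = (\<Union>n. (S n \<inter> A) \<times> T n)" unfolding T_def by auto
    moreover have "S n \<inter> A \<in> sets borel \<and> T n \<in> sets borel" for n
    proof -
      have "open (T n)" unfolding T_def by (rule open_Union) auto
      then show ?thesis using A by (simp add: S_def)
    qed
    ultimately show ?thesis by (intro exI[of _ "\<lambda>n. S n \<inter> A"] exI[of _ T]) blast
  qed
qed

text \<open>Taking the whole space in the other factor gives both cases the same form
  \<open>A \<times> B\<close>, so later arguments need not know which marginal is separable.\<close>

lemma separable_measure_rectangles:
  fixes M :: "'a::metric_space measure" and N :: "'b::metric_space measure"
  assumes M: "prob_space M" and sM: "sets M = sets borel"
    and N: "prob_space N" and sN: "sets N = sets borel"
    and sep: "separable_measure M \<or> separable_measure N"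
  obtains A B where "A \<in> sets M" "measure M A = 1" "B \<in> sets N" "measure N B = 1"
    "\<forall>U. open U \<longrightarrow>
      (\<exists>S T :: nat \<Rightarrow> _. (\<forall>n. S n \<in> sets M \<and> T n \<in> sets N) \<and> U \<inter> (A \<times> B) = (\<Union>n. S n \<times> T n))"
  using sep
proof
  assume "separable_measure M"
  then obtain A where A: "A \<in> sets M" "separable_space (top_of_set A)" "measure M A = 1"
    unfolding separable_measure_def by blast
  show thesis
  proof (rule that[of A "space N"])
    show "\<forall>U. open U \<longrightarrow>
      (\<exists>S T :: nat \<Rightarrow> _. (\<forall>n. S n \<in> sets M \<and> T n \<in> sets N) \<and> U \<inter> (A \<times> space N) = (\<Union>n. S n \<times> T n))"
      unfolding sM sN sets_eq_imp_space_eq[OF sN] space_borel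
      using A sM by (intro allI impI open_Int_separable_rectangles) auto
  qed (use A prob_space.prob_space[OF N] in auto)
next
  assume "separable_measure N"
  then obtain B where B: "B \<in> sets N" "separable_space (top_of_set B)" "measure N B = 1"
    unfolding separable_measure_def by blast
  show thesis
  proof (rule that[of "space M" B])
    have "\<exists>S T :: nat \<Rightarrow> _. (\<forall>n. S n \<in> sets M \<and> T n \<in> sets N) \<and> U \<inter> (space M \<times> B) = (\<Union>n. S n \<times> T n)"
      if "open U" for U :: "('a \<times> 'b) set"
    proof -
      have "open (prod.swap -` U)" using that by (intro open_vimage continuous_on_swap)
      then obtain T :: "nat \<Rightarrow> 'b set" and S :: "nat \<Rightarrow> 'a set" where
        TS: "\<And>n. T n \<in> sets borel \<and> S n \<in> sets borel" "prod.swap -` U \<inter> (B \<times> UNIV) = (\<Union>n. T n \<times> S n)"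
        using open_Int_separable_rectangles[of "prod.swap -` U" B] B sN by auto
      have "U \<inter> (space M \<times> B) = prod.swap -` (prod.swap -` U \<inter> (B \<times> UNIV))"
        using sets_eq_imp_space_eq[OF sM] by auto
      also have "\<dots> = (\<Union>n. S n \<times> T n)" unfolding TS(2) by auto
      finally show ?thesis
        using TS(1) sM sN by blast
    qed
    then show "\<forall>U. open U \<longrightarrow>
      (\<exists>S T :: nat \<Rightarrow> _. (\<forall>n. S n \<in> sets M \<and> T n \<in> sets N) \<and> U \<inter> (space M \<times> B) = (\<Union>n. S n \<times> T n))"
      by blast
  qed (use B prob_space.prob_space[OF M] in auto)
qed

text \<open>The integral of a split function depends on the marginals alone, which is the source of
  weak duality. It is stated for the completion because \<open>c\<close> is integrated
  there.\<close>

lemma coupling_integral_sum: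
  assumes M: "prob_space M" and N: "prob_space N" and P: "P \<in> couplings M N"
    and f: "integrable M f" and g: "integrable N (g :: _ \<Rightarrow> real)"
  shows "integrable (completion P) (\<lambda>z. f (fst z) + g (snd z))"
    and "(\<integral>z. f (fst z) + g (snd z) \<partial>completion P) = integral\<^sup>L M f + integral\<^sup>L N g"
proof -
  have sP: "sets P = sets (M \<Otimes>\<^sub>M N)" using P by (simp add: couplings_def)
  have m1: "fst \<in> measurable P M" and m2: "snd \<in> measurable P N"
    using measurable_cong_sets[OF sP refl, of M] measurable_cong_sets[OF sP refl, of N] by auto
  note marg = coupling_marginals[OF M N P]
  have i: "integrable P (\<lambda>z. f (fst z))" "integrable P (\<lambda>z. g (snd z))"
    using f g m1 m2 marg by (metis integrable_distr)+
  have "(\<integral>z. f (fst z) \<partial>P) = integral\<^sup>L M f"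
    using integral_distr[OF m1, of f] f marg(1) by simp
  moreover have "(\<integral>z. g (snd z) \<partial>P) = integral\<^sup>L N g"
    using integral_distr[OF m2, of g] g marg(2) by simp
  moreover have i2: "integrable P (\<lambda>z. f (fst z) + g (snd z))" using i by simp
  ultimately show "(\<integral>z. f (fst z) + g (snd z) \<partial>completion P) = integral\<^sup>L M f + integral\<^sup>L N g"
    using i by (subst integral_completion) auto
  show "integrable (completion P) (\<lambda>z. f (fst z) + g (snd z))"
    using i2 by (subst integrable_completion) auto
qed

text \<open>The map applied to \<open>c\<close> is continuous and nondecreasing. For nonnegative
  \<open>K\<close> the shift moves the truncated values into \<open>[0, 2 * K]\<close>, the form
  required by the bounded case.\<close>

lemma lower_semicont_truncate:
  assumes "lower_semicont c"
  shows "lower_semicont (\<lambda>z. min (max (c z) (- K)) K + K)"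
  unfolding lower_semicont_def
proof
  fix t
  have "{z. t < min (max (c z) (- K)) K + K} = (if 2 * K \<le> t then {} else if t < 0 then UNIV else {z. t - K < c z})"
    by (auto simp: min_def max_def)
  then show "open {z. t < min (max (c z) (- K)) K + K}"
    using assms by (auto simp: lower_semicont_def)
qed

lemma lower_semicont_bounded_duality:
  fixes M :: "'a::metric_space measure" and N :: "'b::metric_space measure"
  assumes M: "prob_space M" and sM: "sets M = sets borel"
    and N: "prob_space N" and sN: "sets N = sets borel"
    and sep: "separable_measure M \<or> separable_measure N"
    and c: "lower_semicont c" and C: "\<And>z. 0 \<le> c z \<and> c z \<le> C" and e: "e > 0"
  obtains P f g where "P \<in> couplings M N" "integrable M f" "integrable N g"
    "\<And>x y. c (x, y) \<le> f x + g y"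
    "integral\<^sup>L M f + integral\<^sup>L N g \<le> integral\<^sup>L (completion P) c + e"
proof -
  interpret M: prob_space M by fact
  interpret N: prob_space N by fact
  have UM: "space M = UNIV" "space N = UNIV"
    using sets_eq_imp_space_eq[OF sM] sets_eq_imp_space_eq[OF sN] by auto
  obtain A B where A: "A \<in> sets M" "measure M A = 1" and B: "B \<in> sets N" "measure N B = 1"
    and rect: "\<forall>U. open U \<longrightarrow>
      (\<exists>S T :: nat \<Rightarrow> _. (\<forall>n. S n \<in> sets M \<and> T n \<in> sets N) \<and> U \<inter> (A \<times> B) = (\<Union>n. S n \<times> T n))"
    by (rule separable_measure_rectangles[OF M sM N sN sep])
  \<comment> \<open>Cutting \<open>c\<close> off outside \<open>A \<times> B\<close> turns it into a
    countable supremum of rectangle functions, with heights \<open>q i\<close> and rectangles that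
    fill \<open>{z. q i < c z} \<inter> (A \<times> B)\<close>.\<close>
  define c' where "c' z = c z * indicator (A \<times> B) z" for z
  have C0: "0 \<le> C" using C[of undefined] by linarith
  define Q where "Q = \<rat> \<inter> {0..C}"
  have Q: "countable Q" "Q \<noteq> {}" using C0 by (auto simp: Q_def countable_rat)
  define q where "q = from_nat_into Q"
  have q: "range q = Q" using Q by (simp add: q_def)
  have qC: "0 \<le> q i \<and> q i \<le> C" for i using q by (auto simp: Q_def)
  have R: "\<forall>i. \<exists>S T. (\<forall>n :: nat. S n \<in> sets M \<and> T n \<in> sets N) \<and>
      {z. q i < c z} \<inter> (A \<times> B) = (\<Union>n. S n \<times> T n)"
    using c by (intro allI rect[rule_format]) (simp add: lower_semicont_def)
  from choice[OF R] obtain S where R': "\<forall>i. \<exists>T. (\<forall>n :: nat. S i n \<in> sets M \<and> T n \<in> sets N) \<and>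
      {z. q i < c z} \<inter> (A \<times> B) = (\<Union>n. S i n \<times> T n)" ..
  from choice[OF R'] obtain T where R'': "\<forall>i. (\<forall>n :: nat. S i n \<in> sets M \<and> T i n \<in> sets N) \<and>
      {z. q i < c z} \<inter> (A \<times> B) = (\<Union>n. S i n \<times> T i n)" ..
  have ST: "S i n \<in> sets M" "T i n \<in> sets N"
    "{z. q i < c z} \<inter> (A \<times> B) = (\<Union>n. S i n \<times> T i n)" for i n
    using R'' by simp_all
  define a where "a j = q (fst (prod_decode j))" for j
  define S' where "S' j = S (fst (prod_decode j)) (snd (prod_decode j))" for j
  define T' where "T' j = T (fst (prod_decode j)) (snd (prod_decode j))" for j
  have ub: "a j * indicator (S' j \<times> T' j) z \<le> c' z" for j z
  proof (cases "z \<in> S' j \<times> T' j")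
    case True
    then have "z \<in> {z. a j < c z} \<inter> (A \<times> B)" unfolding a_def ST(3) S'_def T'_def by blast
    then show ?thesis using True by (simp add: c'_def)
  qed (use C in \<open>simp add: c'_def\<close>)
  have lub: "\<exists>j. t < a j * indicator (S' j \<times> T' j) z" if t: "t < c' z" for z t
  proof (cases "t < 0")
    case True
    moreover have "0 \<le> a 0 * indicator (S' 0 \<times> T' 0) z" using qC by (simp add: a_def)
    ultimately show ?thesis by (meson less_le_trans)
  next
    case False
    then have z: "z \<in> A \<times> B" "t < c z"
      using t by (cases "z \<in> A \<times> B"; simp add: c'_def)+
    obtain p where p: "p \<in> \<rat>" "t < p" "p < c z" using Rats_dense_in_real[OF z(2)] by blast
    then have "p \<in> Q" using False C[of z] by (auto simp: Q_def)
    then obtain i where i: "q i = p" using q by blast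
    have "z \<in> {z. q i < c z} \<inter> (A \<times> B)" using z p i by simp
    then obtain n where n: "z \<in> S i n \<times> T i n" unfolding ST(3) by blast
    then show ?thesis
      using p i by (intro exI[of _ "prod_encode (i, n)"]) (simp add: a_def S'_def T'_def)
  qed
  have c'C: "c' z \<le> C" and c'c: "c' z \<le> c z" for z
    using C[of z] C0 by (auto simp: c'_def indicator_def)
  have aC: "0 \<le> a j" "a j \<le> C" and ST': "S' j \<in> sets M" "T' j \<in> sets N" for j
    using qC ST(1,2) by (simp_all add: a_def S'_def T'_def)
  show ?thesis
  proof (rule rectangle_sup_duality[OF M N aC(1) ST' ub lub c'C aC(2) e])
    fix P F G
    assume P: "P \<in> couplings M N" "integrable P c'"
      and F: "F \<in> borel_measurable M" "\<And>x. 0 \<le> F x \<and> F x \<le> C"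
      and G: "G \<in> borel_measurable N" "\<And>y. 0 \<le> G y \<and> G y \<le> C"
      and FG: "\<And>x y. x \<in> space M \<Longrightarrow> y \<in> space N \<Longrightarrow> c' (x, y) \<le> F x + G y"
      and le: "integral\<^sup>L M F + integral\<^sup>L N G \<le> integral\<^sup>L P c' + e"
    interpret P: prob_space P using P by (simp add: couplings_def)
    have iF: "integrable M F" using F by (rule M.integrable_between)
    have iG: "integrable N G" using G by (rule N.integrable_between)
    have Ac: "- A \<in> sets M" "measure M (- A) = 0"
      using A M.prob_compl[OF A(1)] sets.compl_sets[OF A(1)] by (auto simp: UM Compl_eq_Diff_UNIV)
    have Bc: "- B \<in> sets N" "measure N (- B) = 0"
      using B N.prob_compl[OF B(1)] sets.compl_sets[OF B(1)] by (auto simp: UM Compl_eq_Diff_UNIV)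
    have iA: "integrable M (\<lambda>x. C * indicator (- A) x)" "(\<integral>x. C * indicator (- A) x \<partial>M) = 0"
      using Ac by (auto simp: M.emeasure_eq_measure UM)
    have iB: "integrable N (\<lambda>x. C * indicator (- B) x)" "(\<integral>x. C * indicator (- B) x \<partial>N) = 0"
      using Bc by (auto simp: N.emeasure_eq_measure UM)
    \<comment> \<open>\<open>c'\<close> is measurable for \<open>P\<close>, whereas \<open>c\<close>
      is known to be so only for the completion; the two are therefore compared there.\<close>
    have "integrable (completion P) c"
      by (rule integrable_completion_coupling[OF M sM N sN, of "\<lambda>_. 0" "\<lambda>_. C" "\<lambda>_. 0" "\<lambda>_. 0"])
        (use C sep c P in auto)
    moreover have "integrable (completion P) c'" "integral\<^sup>L (completion P) c' = integral\<^sup>L P c'"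
      using P(2) by (simp_all add: integrable_completion integral_completion borel_measurable_integrable)
    ultimately have cc: "integral\<^sup>L P c' \<le> integral\<^sup>L (completion P) c"
      using c'c integral_mono[of "completion P" c' c] by simp
    \<comment> \<open>Adding \<open>C\<close> off \<open>A\<close> and off \<open>B\<close> restores
      the inequality for \<open>c\<close> outside \<open>A \<times> B\<close>, and these complements
      are null.\<close>
    show ?thesis
    proof (rule that[OF P(1), of "\<lambda>x. F x + C * indicator (- A) x" "\<lambda>y. G y + C * indicator (- B) y"])
      show "c (x, y) \<le> F x + C * indicator (- A) x + (G y + C * indicator (- B) y)" for x y
        using FG[of x y] F(2)[of x] G(2)[of y] C[of "(x, y)"] C0
        by (auto simp: c'_def UM indicator_def split: if_splits)
      show "(\<integral>x. F x + C * indicator (- A) x \<partial>M) + (\<integral>y. G y + C * indicator (- B) y \<partial>N)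
          \<le> integral\<^sup>L (completion P) c + e"
        unfolding Bochner_Integration.integral_add[OF iF iA(1)] Bochner_Integration.integral_add[OF iG iB(1)]
          iA(2) iB(2) using le cc by simp
    qed (intro Bochner_Integration.integrable_add iF iG iA(1) iB(1))+
  qed
qed

section \<open>Removing boundedness by truncation\<close>

lemma (in prob_space) truncation_error_tendsto_0:
  fixes h :: "'a \<Rightarrow> real"
  assumes h: "integrable M h"
  shows "(\<lambda>m. \<integral>x. max 0 (\<bar>h x\<bar> - real m) \<partial>M) \<longlonglongrightarrow> 0"
proof -
  have "(\<lambda>m. \<integral>x. max 0 (\<bar>h x\<bar> - real m) \<partial>M) \<longlonglongrightarrow> (\<integral>x. 0 \<partial>M)"
  proof (rule integral_dominated_convergence[where w = "\<lambda>x. \<bar>h x\<bar>"])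
    show "AE x in M. (\<lambda>m. max 0 (\<bar>h x\<bar> - real m)) \<longlonglongrightarrow> 0"
    proof (rule AE_I2)
      fix x
      obtain k :: nat where "\<bar>h x\<bar> \<le> real k" using real_arch_simple by blast
      then have "\<forall>\<^sub>F m in sequentially. max 0 (\<bar>h x\<bar> - real m) = 0"
        by (intro eventually_sequentiallyI[of k]) (auto simp: max_def)
      then show "(\<lambda>m. max 0 (\<bar>h x\<bar> - real m)) \<longlonglongrightarrow> 0" by (rule tendsto_eventually)
    qed
  qed (use h in auto)
  then show ?thesis by simp
qed

text \<open>The truncation error of \<open>c\<close> is bounded by a sum of one function of
  \<open>x\<close> and one of \<open>y\<close>. It can therefore be absorbed into the potentials,
  and its integral is the same under every coupling.\<close>

lemma lower_semicont_approx_duality: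
  fixes M :: "'a::metric_space measure" and N :: "'b::metric_space measure"
  assumes M: "prob_space M" and sM: "sets M = sets borel"
    and N: "prob_space N" and sN: "sets N = sets borel"
    and sep: "separable_measure M \<or> separable_measure N"
    and f: "integrable M f1" "integrable M f2" and g: "integrable N g1" "integrable N g2"
    and bounds: "\<And>x y. f1 x + g1 y \<le> c (x, y) \<and> c (x, y) \<le> f2 x + g2 y"
    and c: "lower_semicont c" and e: "e > 0"
  obtains P f g where "P \<in> couplings M N" "integrable M f" "integrable N g"
    "\<And>x y. c (x, y) \<le> f x + g y"
    "integral\<^sup>L M f + integral\<^sup>L N g \<le> integral\<^sup>L (completion P) c + e"
proof -
  interpret M: prob_space M by fact
  interpret N: prob_space N by fact
  define \<phi> where "\<phi> x = \<bar>f1 x\<bar> + \<bar>f2 x\<bar>" for x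
  define \<psi> where "\<psi> y = \<bar>g1 y\<bar> + \<bar>g2 y\<bar>" for y
  have \<phi>: "integrable M \<phi>" and \<psi>: "integrable N \<psi>"
    using f g by (auto simp: \<phi>_def[abs_def] \<psi>_def[abs_def])
  have abs: "\<bar>\<phi> x\<bar> = \<phi> x" "\<bar>\<psi> y\<bar> = \<psi> y" for x y by (auto simp: \<phi>_def \<psi>_def)
  have cb: "\<bar>c (x, y)\<bar> \<le> \<phi> x + \<psi> y" for x y
    using bounds[of x y] unfolding \<phi>_def \<psi>_def by linarith
  define u where "u m x = max 0 (\<bar>\<phi> x\<bar> - real m)" for m x
  define v where "v m y = max 0 (\<bar>\<psi> y\<bar> - real m)" for m y
  have "(\<lambda>m. integral\<^sup>L M (u m) + integral\<^sup>L N (v m)) \<longlonglongrightarrow> 0 + 0"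
    unfolding u_def v_def
    by (intro tendsto_add M.truncation_error_tendsto_0 N.truncation_error_tendsto_0 \<phi> \<psi>)
  then have "\<forall>\<^sub>F m in sequentially. integral\<^sup>L M (u m) + integral\<^sup>L N (v m) < e / 4"
    using e by (intro order_tendstoD) auto
  then obtain m where m: "integral\<^sup>L M (u m) + integral\<^sup>L N (v m) < e / 4"
    by (auto simp: eventually_sequentially)
  have iu: "integrable M (u m)" and iv: "integrable N (v m)"
    using \<phi> \<psi> by (auto simp: u_def[abs_def] v_def[abs_def])
  \<comment> \<open>Twice \<open>m\<close>, because the excess of \<open>\<phi> x + \<psi> y\<close>
    over \<open>2 * real m\<close> is at most the sum of the separate excesses over
    \<open>real m\<close>.\<close>
  define K where "K = 2 * real m"
  define t where "t z = min (max (c z) (- K)) K + K" for z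
  have ct: "c (x, y) \<le> t (x, y) - K + (u m x + v m y)" "t (x, y) - K \<le> c (x, y) + (u m x + v m y)" for x y
    using cb[of x y] unfolding t_def K_def u_def v_def abs by (auto simp: min_def max_def)
  have lt: "lower_semicont t" unfolding t_def using c by (rule lower_semicont_truncate)
  have t01: "0 \<le> t z \<and> t z \<le> 2 * K" for z by (auto simp: t_def K_def min_def max_def)
  obtain P f g where P: "P \<in> couplings M N" and fg: "integrable M f" "integrable N g"
    "\<And>x y. t (x, y) \<le> f x + g y"
    and le: "integral\<^sup>L M f + integral\<^sup>L N g \<le> integral\<^sup>L (completion P) t + e / 4"
    by (rule lower_semicont_bounded_duality[OF M sM N sN sep lt t01, of "e / 4"]) (use e in auto)
  interpret P: prob_space P using P by (simp add: couplings_def)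
  interpret cP: prob_space "completion P" by (rule P.prob_space_completion)
  have ic: "integrable (completion P) c"
    by (rule integrable_completion_coupling[OF M sM N sN f g bounds sep _ P]) (use c in simp)
  have it: "integrable (completion P) t"
    by (rule integrable_completion_coupling[OF M sM N sN, of "\<lambda>_. 0" "\<lambda>_. 2 * K" "\<lambda>_. 0" "\<lambda>_. 0"])
      (use t01 sep lt P in auto)
  note uv = coupling_integral_sum[OF M N P iu iv]
  have "(\<integral>z. t z - K \<partial>completion P) \<le> (\<integral>z. c z + (u m (fst z) + v m (snd z)) \<partial>completion P)"
    using it ic uv(1) ct(2) by (intro integral_mono) auto
  then have tc: "integral\<^sup>L (completion P) t - K \<le> integral\<^sup>L (completion P) c + e / 4"
    using it ic uv m cP.prob_space by (simp del: space_completion)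
  \<comment> \<open>The error budget is \<open>e / 4\<close> from the bounded case plus the
    truncation error, below \<open>e / 4\<close>, spent twice: once in comparing \<open>t\<close>
    with \<open>c\<close> under \<open>P\<close>, once in the corrected potentials.\<close>
  show ?thesis
  proof (rule that[OF P, of "\<lambda>x. f x - K + u m x" "\<lambda>y. g y + v m y"])
    show "c (x, y) \<le> f x - K + u m x + (g y + v m y)" for x y
      using ct(1)[of x y] fg(3)[of x y] by linarith
    have "(\<integral>x. f x - K + u m x \<partial>M) = integral\<^sup>L M f - K + integral\<^sup>L M (u m)"
      using fg(1) iu by (simp add: M.prob_space)
    moreover have "(\<integral>y. g y + v m y \<partial>N) = integral\<^sup>L N g + integral\<^sup>L N (v m)"
      using fg(2) iv by simp
    ultimately show "(\<integral>x. f x - K + u m x \<partial>M) + (\<integral>y. g y + v m y \<partial>N) \<le> integral\<^sup>L (completion P) c + e"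
      using le tc m e by argo
  qed (use fg iu iv in auto)
qed

section \<open>Equality of the values and reflection to upper semicontinuous functions\<close>

lemma primal_sup_eq_dual_inf:
  fixes M :: "'a::metric_space measure" and N :: "'b::metric_space measure"
  assumes M: "prob_space M" and sM: "sets M = sets borel"
    and N: "prob_space N" and sN: "sets N = sets borel"
    and sep: "separable_measure M \<or> separable_measure N"
    and f: "integrable M f1" "integrable M f2" and g: "integrable N g1" "integrable N g2"
    and bounds: "\<And>x y. f1 x + g1 y \<le> c (x, y) \<and> c (x, y) \<le> f2 x + g2 y"
    and c: "lower_semicont c"
  shows "primal_sup M N c = dual_inf M N c"
proof (rule antisym)
  have UM: "space M = UNIV" "space N = UNIV"
    using sets_eq_imp_space_eq[OF sM] sets_eq_imp_space_eq[OF sN] by auto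
  show "primal_sup M N c \<le> dual_inf M N c"
    unfolding primal_sup_def dual_inf_def
  proof (intro SUP_least Inf_greatest)
    fix P r
    assume P: "P \<in> couplings M N"
      and "r \<in> {ereal (integral\<^sup>L M f + integral\<^sup>L N g) | f g. integrable M f \<and> integrable N g \<and>
        (\<forall>x\<in>space M. \<forall>y\<in>space N. c (x, y) \<le> f x + g y)}"
    then obtain f' g' where r: "r = ereal (integral\<^sup>L M f' + integral\<^sup>L N g')"
      and fg: "integrable M f'" "integrable N g'" "\<And>x y. c (x, y) \<le> f' x + g' y"
      by (auto simp: UM)
    have "integrable (completion P) c"
      by (rule integrable_completion_coupling[OF M sM N sN f g bounds sep _ P]) (use c in simp)
    then have "integral\<^sup>L (completion P) c \<le> (\<integral>z. f' (fst z) + g' (snd z) \<partial>completion P)"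
      using coupling_integral_sum(1)[OF M N P fg(1,2)] fg(3) by (intro integral_mono) auto
    then show "ereal (integral\<^sup>L (completion P) c) \<le> r"
      by (simp add: r coupling_integral_sum(2)[OF M N P fg(1,2)])
  qed
  show "dual_inf M N c \<le> primal_sup M N c"
  proof (rule ereal_le_epsilon2)
    fix e :: real assume e: "0 < e"
    obtain P f' g' where P: "P \<in> couplings M N" and fg: "integrable M f'" "integrable N g'"
      "\<And>x y. c (x, y) \<le> f' x + g' y"
      and le: "integral\<^sup>L M f' + integral\<^sup>L N g' \<le> integral\<^sup>L (completion P) c + e"
      by (rule lower_semicont_approx_duality[OF M sM N sN sep f g bounds c e]) blast
    have "dual_inf M N c \<le> ereal (integral\<^sup>L M f' + integral\<^sup>L N g')"
      unfolding dual_inf_def using fg by (intro Inf_lower) blast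
    also have "\<dots> \<le> ereal (integral\<^sup>L (completion P) c) + ereal e" using le by simp
    also have "\<dots> \<le> primal_sup M N c + ereal e"
      unfolding primal_sup_def using P by (intro add_right_mono SUP_upper)
    finally show "dual_inf M N c \<le> primal_sup M N c + ereal e" .
  qed
qed

lemma primal_inf_uminus: "primal_inf M N c = - primal_sup M N (\<lambda>z. - c z)"
  unfolding primal_inf_def primal_sup_def 
  by (simp only: Bochner_Integration.integral_minus uminus_ereal.simps(1)[symmetric] ereal_SUP_uminus_eq
      ereal_uminus_uminus)

lemma dual_sup_uminus: "dual_sup M N c = - dual_inf M N (\<lambda>z. - c z)"
proof -
  have "{ereal (integral\<^sup>L M f + integral\<^sup>L N g) | f g. integrable M f \<and> integrable N g \<and>
        (\<forall>x\<in>space M. \<forall>y\<in>space N. f x + g y \<le> c (x, y))} =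
      uminus ` {ereal (integral\<^sup>L M f + integral\<^sup>L N g) | f g. integrable M f \<and> integrable N g \<and>
        (\<forall>x\<in>space M. \<forall>y\<in>space N. - c (x, y) \<le> f x + g y)}" (is "?L = uminus ` ?R")
  proof (intro equalityI subsetI)
    fix r assume "r \<in> ?L"
    then obtain f g where fg: "r = ereal (integral\<^sup>L M f + integral\<^sup>L N g)" "integrable M f" "integrable N g"
      "\<forall>x\<in>space M. \<forall>y\<in>space N. f x + g y \<le> c (x, y)" by blast
    have "- c (x, y) \<le> - f x + - g y" if "x \<in> space M" "y \<in> space N" for x y
      using fg(4) that by fastforce
    then have "- r \<in> ?R"
      using fg(1-3) by (intro CollectI exI[of _ "\<lambda>x. - f x"] exI[of _ "\<lambda>y. - g y"]) simp
    then have "- (- r) \<in> uminus ` ?R" by (rule imageI)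
    then show "r \<in> uminus ` ?R" by (simp only: ereal_uminus_uminus)
  next
    fix r assume "r \<in> uminus ` ?R"
    then obtain f g where fg: "r = - ereal (integral\<^sup>L M f + integral\<^sup>L N g)" "integrable M f" "integrable N g"
      "\<forall>x\<in>space M. \<forall>y\<in>space N. - c (x, y) \<le> f x + g y" by blast
    have "- f x + - g y \<le> c (x, y)" if "x \<in> space M" "y \<in> space N" for x y
      using fg(4) that by fastforce
    then show "r \<in> ?L"
      using fg(1-3) by (intro CollectI exI[of _ "\<lambda>x. - f x"] exI[of _ "\<lambda>y. - g y"]) simp
  qed
  then show ?thesis
    unfolding dual_sup_def dual_inf_def by (simp only: ereal_Sup_uminus_image_eq)
qed

theorem theorem9:
  fixes \<mu> :: "'a::metric_space measure" and \<nu> :: "'b::metric_space measure"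
    and c :: "'a \<times> 'b \<Rightarrow> real"
  assumes "prob_space \<mu>" and "sets \<mu> = sets borel"
    and "prob_space \<nu>" and "sets \<nu> = sets borel"
    and "\<exists>f1 f2 g1 g2. integrable \<mu> f1 \<and> integrable \<mu> f2 \<and> integrable \<nu> g1 \<and> integrable \<nu> g2 \<and>
           (\<forall>x y. f1 x + g1 y \<le> c (x, y) \<and> c (x, y) \<le> f2 x + g2 y)"
    and "separable_measure \<mu> \<or> separable_measure \<nu>"
  shows "(lower_semicont c \<longrightarrow> primal_sup \<mu> \<nu> c = dual_inf \<mu> \<nu> c) \<and>
         (upper_semicont c \<longrightarrow> primal_inf \<mu> \<nu> c = dual_sup \<mu> \<nu> c)"
proof -
  obtain f1 f2 g1 g2 where fg: "integrable \<mu> f1" "integrable \<mu> f2" "integrable \<nu> g1" "integrable \<nu> g2"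
    and bounds: "\<And>x y. f1 x + g1 y \<le> c (x, y) \<and> c (x, y) \<le> f2 x + g2 y"
    using assms(5) by blast
  have "primal_sup \<mu> \<nu> c = dual_inf \<mu> \<nu> c" if "lower_semicont c"
    by (rule primal_sup_eq_dual_inf[OF assms(1-4,6) fg bounds that])
  moreover have "primal_inf \<mu> \<nu> c = dual_sup \<mu> \<nu> c" if "upper_semicont c"
  proof -
    have "{z. t < - c z} = {z. c z < - t}" for t by auto
    then have "lower_semicont (\<lambda>z. - c z)"
      using that by (simp add: lower_semicont_def upper_semicont_def)
    moreover have "- f2 x + - g2 y \<le> - c (x, y) \<and> - c (x, y) \<le> - f1 x + - g1 y" for x y
      using bounds[of x y] by simp
    ultimately have "primal_sup \<mu> \<nu> (\<lambda>z. - c z) = dual_inf \<mu> \<nu> (\<lambda>z. - c z)"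
      using fg by (intro primal_sup_eq_dual_inf[OF assms(1-4,6), of "\<lambda>x. - f2 x" "\<lambda>x. - f1 x"
            "\<lambda>y. - g2 y" "\<lambda>y. - g1 y"]) auto
    then show ?thesis unfolding primal_inf_uminus dual_sup_uminus by (rule arg_cong)
  qed
  ultimately show ?thesis by blast
qed

end
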